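(* Let $v_1=e^{\phi_1}$, $v_2=e^{\phi_2}$, $v_3=e^{-\phi_1-\phi_2}$. The system $$\phi_{1,t}=\phi_{1,xx}+2\phi_{2,xx}+2\phi_{1,x}\phi_{2,x}+\phi_{1,x}^2+3e^{2\phi_2}-3e^{-2\phi_1-2\phi_2},$$ $$\phi_{2,t}=-2\phi_{1,xx}-\phi_{2,xx}-2\phi_{1,x}\phi_{2,x}-\phi_{2,x}^2-3e^{2\phi_1}+3e^{-2\phi_1-2\phi_2}$$ possesses a recursion operator $\Re=\begin{pmatrix}\Re_{11}&\Re_{12}\\ \Re_{21}&\Re_{22}\end{pmatrix}$ of order $3$ with entries $$\begin{aligned}\Re_{11}(\phi_1,\phi_2)=&\tfrac13D_x^3+\tfrac23(\phi_{1,x}+\phi_{2,x})D_x^2\\&+\tfrac19(3\phi_{1,xx}-\phi_{1,x}\phi_{2,x}+3\phi_{2,xx}-\phi_{1,x}^2-\phi_{2,x}^2+21v_3^2+3v_2^2+3v_1^2)D_x\\&-\tfrac19(7\phi_{1,x}\phi_{2,xx}+\phi_{1,xx}\phi_{2,x}+2\phi_{1,x}\phi_{1,xx}+2\phi_{2,x}\phi_{2,xx}+4\phi_{1,x}^3+7\phi_{1,x}^2\phi_{2,x}+\phi_{1,x}\phi_{2,x}^2)\\&+\tfrac13(5v_1^2-4v_2^2-7v_3^2)\phi_{1,x}+\tfrac13(8v_1^2-v_2^2-13v_3^2)\phi_{2,x}\\&-\tfrac19\phi_{1,x}D_x^{-1}s_{2,\phi_1}-\tfrac19\phi_{1,t}D_x^{-1}s_{1,\phi_1},\end{aligned}$$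 $$\begin{aligned}\Re_{12}(\phi_1,\phi_2)=&\tfrac23D_x^3+\tfrac23\phi_{1,x}D_x^2+\tfrac19(3\phi_{1,xx}-2\phi_{1,x}^2-2\phi_{1,x}\phi_{2,x}-2\phi_{2,x}^2+6v_1^2+24v_2^2+24v_3^2)D_x\\&+\tfrac29(\phi_{1,x}\phi_{1,xx}-\phi_{1,x}\phi_{2,xx}-\phi_{2,x}\phi_{1,xx}-2\phi_{2,x}\phi_{2,xx}-\phi_{1,x}^3-\phi_{1,x}^2\phi_{2,x}-\phi_{1,x}\phi_{2,x}^2)\\&+\tfrac23(v_1^2+v_2^2-5v_3^2)\phi_{1,x}+4(v_2^2-v_3^2)\phi_{2,x}-\tfrac19\phi_{1,x}D_x^{-1}s_{2,\phi_2}-\tfrac19\phi_{1,t}D_x^{-1}s_{1,\phi_2},\end{aligned}$$ $\Re_{21}(\phi_1,\phi_2)=-\Re_{12}(\phi_2,\phi_1)$ and $\Re_{22}(\phi_1,\phi_2)=-\Re_{11}(\phi_2,\phi_1)$. Here $\phi_{1,t},\phi_{2,t}$ stand for the right-hand sides of the system and $$s_{1,\phi_1}=-2\phi_{1,xx}-\phi_{2,xx}-6e^{2\phi_1}+6e^{-2\phi_1-2\phi_2},\qquad s_{1,\phi_2}=-\phi_{1,xx}-2\phi_{2,xx}-6e^{2\phi_2}+6e^{-2\phi_1-2\phi_2},$$ $$\begin{aligned}s_{2,\phi_1}=&-3\phi_{2,xxx}-4\phi_{1,x}\phi_{1,xx}+2\phi_{2,x}\phi_{2,xx}-2\phi_{1,xx}\phi_{2,x}-2\phi_{1,x}\phi_{2,xx}\\&-12(e^{2\phi_1}+e^{2\phi_2}+e^{-2\phi_1-2\phi_2})\phi_{2,x},\\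 s_{2,\phi_2}=&\;3\phi_{1,xxx}-2\phi_{1,x}\phi_{1,xx}+4\phi_{2,x}\phi_{2,xx}+2\phi_{1,xx}\phi_{2,x}+2\phi_{1,x}\phi_{2,xx}\\&+12(e^{2\phi_1}+e^{2\phi_2}+e^{-2\phi_1-2\phi_2})\phi_{1,x}.\end{aligned}$$
   Context: The dependent variable is $u=(\phi_1,\phi_2)^T$; $\mathcal A$ is the differential ring of smooth functions of $\phi_1,\phi_2$ and finitely many $x$-derivatives, with total derivative $D_x$; $\mathfrak h=\mathcal A^2$. $D_x^{-1}$ is the (left) inverse of $D_x$; operators are formal matrix pseudo-differential operators, and e.g. $\phi_{1,x}D_x^{-1}s$ means $w\mapsto\phi_{1,x}D_x^{-1}(s\,w)$. The order of an operator is its highest power of $D_x$. $F(\phi_2,\phi_1)$ denotes the operator obtained from $F(\phi_1,\phi_2)$ by interchanging $\phi_1$ and $\phi_2$ in every coefficient, after all of them (including $v_i$, $s_{i,\phi_j}$, $\phi_{i,t}$) have been written explicitly in terms of $\phi_1,\phi_2$ and their $x$-derivatives. For an evolution equation $u_t=K$, $K\in\mathfrak h$, an operator $\Re:\mathfrak h\to\mathfrak h$ is a recursion operator if its Lie derivative along $K$ vanishes: $L_K\Re=D_\Re[K]-D_K\Re+\Re D_K=0$, where $D_K=\sum_i\frac{\partial K}{\partial u_i}D_x^i$ ($u_i=\partial_x^iu$) is the Fréchet derivative of $K$, and $D_\Re[K]$ is the operator obtained by differentiating the coefficients of $\Re$ in the direction $K$ (i.e. applying $\sum_k D_x^kK\cdot\partial/\partial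 u_k$ to them). *)

theory Defs
  imports "HOL-Analysis.Analysis"
begin

section \<open>Differential functions\<close>

text \<open>A point of jet space assigns to \<open>(j, k)\<close> the value of the \<open>k\<close>-th \<open>x\<close>-derivative
  of the \<open>j\<close>-th dependent variable.\<close>

type_synonym jet = "2 \<times> nat \<Rightarrow> real"

definition pdiff :: "2 \<times> nat \<Rightarrow> (jet \<Rightarrow> real) \<Rightarrow> jet \<Rightarrow> real" where
  "pdiff v f u = deriv (\<lambda>t. f (u(v := t))) (u v)"

primrec Ck :: "nat \<Rightarrow> (jet \<Rightarrow> real) \<Rightarrow> bool" where
  "Ck 0 f \<longleftrightarrow> continuous_on UNIV f"
| "Ck (Suc n) f \<longleftrightarrow> continuous_on UNIV f
     \<and> (\<forall>v u. (\<lambda>t. f (u(v := t))) field_differentiable (at (u v)))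
     \<and> (\<forall>v. Ck n (pdiff v f))"

definition finite_jet :: "(jet \<Rightarrow> real) \<Rightarrow> bool" where
  "finite_jet f \<longleftrightarrow> (\<exists>n. \<forall>u w. (\<forall>j. \<forall>k\<le>n. u (j, k) = w (j, k)) \<longrightarrow> f u = f w)"

text \<open>Continuity refers to the product topology on jet space; for functions of finitely many
  jet coordinates this is continuity in those coordinates.\<close>

definition diff_functions :: "(jet \<Rightarrow> real) set" where
  "diff_functions = {f. finite_jet f \<and> (\<forall>n. Ck n f)}"

lemma Ck_continuous: "Ck n f \<Longrightarrow> continuous_on UNIV f"
  by (cases n) auto

lemma Ck_Suc_D: "Ck (Suc n) f \<Longrightarrow> Ck n f"
  by (induction n arbitrary: f) auto

lemma Ck_field_differentiable:
  "Ck (Suc n) f \<Longrightarrow> (\<lambda>t. f (u(v := t))) field_differentiable at (u v)"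
  by (simp del: split_paired_All)

lemma Ck_has_derivative:
  "Ck (Suc n) f \<Longrightarrow> ((\<lambda>t. f (u(v := t))) has_field_derivative pdiff v f u) (at (u v))"
  unfolding pdiff_def by (rule field_differentiable_derivI[OF Ck_field_differentiable])

lemma pdiff_const: "pdiff v (\<lambda>_. c) = (\<lambda>_. 0)"
  by (simp add: pdiff_def fun_eq_iff)

lemma Ck_const: "Ck n (\<lambda>_. c)"
  by (induction n arbitrary: c) (auto simp: pdiff_const)

lemma pdiff_coord: "pdiff v (\<lambda>u. u w) = (\<lambda>_. if v = w then 1 else 0)"
  by (auto simp: pdiff_def fun_eq_iff)

lemma Ck_coord: "Ck n (\<lambda>u. u w)"
proof (cases n)
  case (Suc m)
  have "(\<lambda>t. (u(v := t)) w) field_differentiable at (u v)" for v u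
    by (cases "v = w") (auto intro: field_differentiable_const field_differentiable_ident)
  then show ?thesis using Suc by (auto simp: pdiff_coord Ck_const)
qed auto

lemma pdiff_add:
  assumes "Ck (Suc n) f" "Ck (Suc n) g"
  shows "pdiff v (\<lambda>u. f u + g u) = (\<lambda>u. pdiff v f u + pdiff v g u)"
proof
  fix u
  show "pdiff v (\<lambda>u. f u + g u) u = pdiff v f u + pdiff v g u"
    unfolding pdiff_def[of v "\<lambda>u. f u + g u"]
    by (rule DERIV_imp_deriv[OF DERIV_add[OF assms[THEN Ck_has_derivative]]])
qed

lemma Ck_add: "Ck n f \<Longrightarrow> Ck n g \<Longrightarrow> Ck n (\<lambda>u. f u + g u)"
proof (induction n arbitrary: f g)
  case (Suc n)
  show ?case unfolding Ck.simps pdiff_add[OF Suc.prems]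
    using Suc by (auto intro!: continuous_on_add field_differentiable_add)
qed (auto intro: continuous_on_add)

lemma pdiff_mult:
  assumes "Ck (Suc n) f" "Ck (Suc n) g"
  shows "pdiff v (\<lambda>u. f u * g u) = (\<lambda>u. f u * pdiff v g u + pdiff v f u * g u)"
proof
  fix u
  show "pdiff v (\<lambda>u. f u * g u) u = f u * pdiff v g u + pdiff v f u * g u"
    unfolding pdiff_def[of v "\<lambda>u. f u * g u"]
    using DERIV_imp_deriv[OF DERIV_mult[OF assms[THEN Ck_has_derivative, of u v]]]
    by simp
qed

lemma Ck_mult: "Ck n f \<Longrightarrow> Ck n g \<Longrightarrow> Ck n (\<lambda>u. f u * g u)"
proof (induction n arbitrary: f g)
  case (Suc n)
  have "Ck n f" "Ck n g" using Suc.prems by (auto dest: Ck_Suc_D simp del: Ck.simps)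
  then show ?case unfolding Ck.simps pdiff_mult[OF Suc.prems]
    using Suc by (auto intro!: continuous_on_mult field_differentiable_mult Ck_add)
qed (auto intro: continuous_on_mult)

lemma pdiff_exp:
  assumes "Ck (Suc n) f"
  shows "pdiff v (\<lambda>u. exp (f u)) = (\<lambda>u. exp (f u) * pdiff v f u)"
proof
  fix u
  have "((\<lambda>t. exp (f (u(v := t)))) has_field_derivative
      exp (f (u(v := u v))) * pdiff v f u) (at (u v))"
    by (rule DERIV_fun_exp[OF Ck_has_derivative[OF assms]])
  then show "pdiff v (\<lambda>u. exp (f u)) u = exp (f u) * pdiff v f u"
    unfolding pdiff_def[of v "\<lambda>u. exp (f u)"] by (simp add: DERIV_imp_deriv)
qed

lemma Ck_exp: "Ck n f \<Longrightarrow> Ck n (\<lambda>u. exp (f u))"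
proof (induction n arbitrary: f)
  case (Suc n)
  have "Ck n f" using Suc.prems by (rule Ck_Suc_D)
  moreover have "(\<lambda>t. exp (f (u(v := t)))) field_differentiable at (u v)" for u v
    unfolding field_differentiable_def
    using DERIV_fun_exp[OF Ck_has_derivative[OF Suc.prems]] by blast
  ultimately show ?case unfolding Ck.simps pdiff_exp[OF Suc.prems]
    using Suc by (auto intro!: continuous_on_exp Ck_mult)
qed (auto intro: continuous_on_exp)

lemma finite_jet_const: "finite_jet (\<lambda>_. c)"
  by (simp add: finite_jet_def)

lemma finite_jet_comp: "finite_jet f \<Longrightarrow> finite_jet (\<lambda>u. h (f u))"
  unfolding finite_jet_def by metis

lemma finite_jet_comp2:
  assumes "finite_jet f" "finite_jet g"
  shows "finite_jet (\<lambda>u. h (f u) (g u))"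
proof -
  obtain n where n: "\<And>u w. (\<forall>j. \<forall>k\<le>n. u (j, k) = w (j, k)) \<Longrightarrow> f u = f w"
    using assms(1) unfolding finite_jet_def by blast
  obtain m where m: "\<And>u w. (\<forall>j. \<forall>k\<le>m. u (j, k) = w (j, k)) \<Longrightarrow> g u = g w"
    using assms(2) unfolding finite_jet_def by blast
  show ?thesis unfolding finite_jet_def
    by (rule exI[of _ "max n m"]) (metis m n max.coboundedI1 max.coboundedI2)
qed

lemma finite_jet_coord: "finite_jet (\<lambda>u. u v)"
  unfolding finite_jet_def by (rule exI[of _ "snd v"]) (metis order_refl prod.collapse)

lemma finite_jet_pdiff: "finite_jet f \<Longrightarrow> finite_jet (pdiff v f)"
proof -
  assume "finite_jet f"
  then obtain n where n: "\<And>u w. (\<forall>j. \<forall>k\<le>n. u (j, k) = w (j, k)) \<Longrightarrow> f u = f w"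
    unfolding finite_jet_def by blast
  have "pdiff v f u = pdiff v f w"
    if "\<forall>j. \<forall>k\<le>max n (snd v). u (j, k) = w (j, k)" for u w
  proof -
    have "f (u(v := t)) = f (w(v := t))" for t
      by (rule n) (use that in auto)
    moreover have "u v = w v"
      using that by (metis max.cobounded2 prod.collapse)
    ultimately show ?thesis by (simp add: pdiff_def)
  qed
  then show ?thesis unfolding finite_jet_def by blast
qed

lemma finite_pdiff_support:
  assumes "finite_jet f"
  shows "finite {v. pdiff v f \<noteq> (\<lambda>_. 0)}"
proof -
  obtain n where n: "\<And>u w. (\<forall>j. \<forall>k\<le>n. u (j, k) = w (j, k)) \<Longrightarrow> f u = f w"
    using assms unfolding finite_jet_def by blast
  have "pdiff v f = (\<lambda>_. 0)" if "snd v > n" for v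
  proof
    fix u
    have "f (u(v := t)) = f u" for t
      by (rule n) (use that in auto)
    then show "pdiff v f u = 0" by (simp add: pdiff_def)
  qed
  then have "{v. pdiff v f \<noteq> (\<lambda>_. 0)} \<subseteq> UNIV \<times> {..n}"
    by (auto simp: not_less[symmetric])
  then show ?thesis by (rule finite_subset) auto
qed

typedef dfun = diff_functions
  morphisms dfun_apply Abs_dfun
  unfolding diff_functions_def using finite_jet_const Ck_const by blast

setup_lifting type_definition_dfun

instantiation dfun :: "{comm_ring_1, real_algebra_1}"
begin

lift_definition zero_dfun :: dfun is "\<lambda>_. 0"
  by (simp add: diff_functions_def finite_jet_const Ck_const)

lift_definition one_dfun :: dfun is "\<lambda>_. 1"
  by (simp add: diff_functions_def finite_jet_const Ck_const)

lift_definition plus_dfun :: "dfun \<Rightarrow> dfun \<Rightarrow> dfun" is "\<lambda>f g u. f u + g u"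
  by (simp add: diff_functions_def finite_jet_comp2 Ck_add)

lift_definition times_dfun :: "dfun \<Rightarrow> dfun \<Rightarrow> dfun" is "\<lambda>f g u. f u * g u"
  by (simp add: diff_functions_def finite_jet_comp2 Ck_mult)

lift_definition scaleR_dfun :: "real \<Rightarrow> dfun \<Rightarrow> dfun" is "\<lambda>c f u. c * f u"
  by (simp add: diff_functions_def finite_jet_comp Ck_mult Ck_const)

lift_definition uminus_dfun :: "dfun \<Rightarrow> dfun" is "\<lambda>f u. - f u"
proof -
  fix f :: "jet \<Rightarrow> real" assume "f \<in> diff_functions"
  then have "(\<lambda>u. (- 1) * f u) \<in> diff_functions"
    unfolding diff_functions_def by (simp only: mem_Collect_eq finite_jet_comp Ck_mult Ck_const simp_thms)
  then show "(\<lambda>u. - f u) \<in> diff_functions" by simp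
qed

definition minus_dfun :: "dfun \<Rightarrow> dfun \<Rightarrow> dfun" where
  "minus_dfun f g = f + - g"

instance
proof
  show "(0::dfun) \<noteq> 1" by transfer (metis zero_neq_one)
  show "f - g = f + - g" for f g :: dfun by (rule minus_dfun_def)
qed (transfer; simp add: fun_eq_iff algebra_simps)+

end

lift_definition jvar :: "2 \<Rightarrow> nat \<Rightarrow> dfun" is "\<lambda>j k u. u (j, k)"
  by (simp add: diff_functions_def finite_jet_coord Ck_coord)

lift_definition dexp :: "dfun \<Rightarrow> dfun" is "\<lambda>f u. exp (f u)"
  by (simp add: diff_functions_def finite_jet_comp Ck_exp)

lift_definition pd :: "2 \<times> nat \<Rightarrow> dfun \<Rightarrow> dfun" is pdiff
  unfolding diff_functions_def mem_Collect_eq by (metis finite_jet_pdiff Ck.simps(2))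

text \<open>The vector field \<open>\<Sum>\<^sub>v Q\<^sub>v \<partial>/\<partial>u\<^sub>v\<close> on jet space; each differential function
  depends on finitely many coordinates, so the sum is finite.\<close>

definition vfield :: "(2 \<times> nat \<Rightarrow> dfun) \<Rightarrow> dfun \<Rightarrow> dfun" where
  "vfield Q f = (\<Sum>v | pd v f \<noteq> 0. Q v * pd v f)"

definition Dx :: "dfun \<Rightarrow> dfun" where
  "Dx = vfield (\<lambda>(j, k). jvar j (Suc k))"

definition evolve :: "dfun ^ 2 \<Rightarrow> dfun \<Rightarrow> dfun" where
  "evolve K = vfield (\<lambda>(j, k). (Dx ^^ k) (K $ j))"

lemma finite_pd_support: "finite {v. pd v f \<noteq> 0}"
  by transfer (simp add: diff_functions_def finite_pdiff_support)

lemma pd_zero [simp]: "pd v 0 = 0"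
  by transfer (rule pdiff_const)

lemma pd_one [simp]: "pd v 1 = 0"
  by transfer (rule pdiff_const)

lemma pd_add: "pd v (f + g) = pd v f + pd v g"
  by transfer (auto simp: diff_functions_def intro: pdiff_add)

lemma pd_mult: "pd v (f * g) = f * pd v g + pd v f * g"
  by transfer (auto simp: diff_functions_def intro: pdiff_mult)

lemma pd_scaleR: "pd v (c *\<^sub>R f) = c *\<^sub>R pd v f"
proof (transfer, goal_cases)
  case (1 v c f)
  then show ?case
    using pdiff_mult[of 0 "\<lambda>_. c" f v, OF Ck_const] by (simp add: diff_functions_def pdiff_const)
qed

lemma pd_exp: "pd v (dexp f) = dexp f * pd v f"
  by transfer (auto simp: diff_functions_def intro: pdiff_exp)

lemma pd_jvar: "pd v (jvar j k) = (if v = (j, k) then 1 else 0)"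
  by transfer (auto simp: pdiff_coord)

lemma vfield_superset:
  assumes "finite S" "{v. pd v f \<noteq> 0} \<subseteq> S"
  shows "vfield Q f = (\<Sum>v\<in>S. Q v * pd v f)"
  unfolding vfield_def by (rule sum.mono_neutral_left) (use assms in auto)

lemma vfield_zero [simp]: "vfield Q 0 = 0"
  by (simp add: vfield_def)

lemma vfield_one [simp]: "vfield Q 1 = 0"
  by (simp add: vfield_def)

lemma vfield_add: "vfield Q (f + g) = vfield Q f + vfield Q g"
proof -
  let ?S = "{v. pd v f \<noteq> 0} \<union> {v. pd v g \<noteq> 0}"
  have "finite ?S" by (simp add: finite_pd_support)
  moreover have "{v. pd v (f + g) \<noteq> 0} \<subseteq> ?S" by (auto simp: pd_add)
  ultimately show ?thesis
    by (simp add: vfield_superset[of ?S] pd_add distrib_left sum.distrib)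
qed

lemma vfield_mult: "vfield Q (f * g) = f * vfield Q g + vfield Q f * g"
proof -
  let ?S = "{v. pd v f \<noteq> 0} \<union> {v. pd v g \<noteq> 0}"
  have "finite ?S" by (simp add: finite_pd_support)
  moreover have "{v. pd v (f * g) \<noteq> 0} \<subseteq> ?S" by (auto simp: pd_mult)
  ultimately show ?thesis
    by (simp add: vfield_superset[of ?S] pd_mult algebra_simps sum.distrib
        sum_distrib_left sum_distrib_right)
qed

lemma vfield_scaleR: "vfield Q (c *\<^sub>R f) = c *\<^sub>R vfield Q f"
proof -
  let ?S = "{v. pd v f \<noteq> 0}"
  have "{v. pd v (c *\<^sub>R f) \<noteq> 0} \<subseteq> ?S" by (auto simp: pd_scaleR)
  then show ?thesis
    by (simp add: vfield_superset[of ?S] finite_pd_support pd_scaleR scaleR_sum_right)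
qed

lemma vfield_exp: "vfield Q (dexp f) = dexp f * vfield Q f"
proof -
  let ?S = "{v. pd v f \<noteq> 0}"
  have "{v. pd v (dexp f) \<noteq> 0} \<subseteq> ?S" by (auto simp: pd_exp)
  then show ?thesis
    by (simp add: vfield_superset[of ?S] finite_pd_support pd_exp sum_distrib_left algebra_simps)
qed

lemma vfield_jvar: "vfield Q (jvar j k) = Q (j, k)"
  by (subst vfield_superset[of "{(j, k)}"]) (auto simp: pd_jvar)

lemma Dx_jvar: "Dx (jvar j k) = jvar j (Suc k)"
  by (simp add: Dx_def vfield_jvar)

lemma Dx_zero [simp]: "Dx 0 = 0"
  by (simp add: Dx_def)

lemma Dx_one [simp]: "Dx 1 = 0"
  by (simp add: Dx_def)

lemma Dx_pow_zero [simp]: "(Dx ^^ n) 0 = 0"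
  by (induction n) (simp_all add: Dx_def)

lemma Dx_pow_one: "(Dx ^^ n) 1 = (if n = 0 then 1 else 0)"
  by (induction n) (simp_all add: Dx_def)

lemma Dx_pow_add: "(Dx ^^ n) (f + g) = (Dx ^^ n) f + (Dx ^^ n) g"
  by (induction n) (simp_all add: Dx_def vfield_add)

lemma Dx_pow_scaleR: "(Dx ^^ n) (c *\<^sub>R f) = c *\<^sub>R (Dx ^^ n) f"
  by (induction n) (simp_all add: Dx_def vfield_scaleR)

lemma Dx_pow_sum: "(Dx ^^ n) (sum f A) = (\<Sum>a\<in>A. (Dx ^^ n) (f a))"
  by (induction A rule: infinite_finite_induct) (simp_all add: Dx_pow_add)

lemma Dx_pow_mult:
  "(Dx ^^ n) (f * g) = (\<Sum>k\<le>n. of_nat (n choose k) * ((Dx ^^ k) f * (Dx ^^ (n - k)) g))"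
proof (induction n arbitrary: f g)
  case (Suc n)
  let ?a = "\<lambda>k m. (Dx ^^ k) f * (Dx ^^ m) g"
  have "(Dx ^^ Suc n) (f * g) = (Dx ^^ n) (f * Dx g) + (Dx ^^ n) (Dx f * g)"
    unfolding funpow_Suc_right o_apply by (simp add: Dx_def vfield_mult Dx_pow_add[unfolded Dx_def])
  also have "(Dx ^^ n) (f * Dx g) = (\<Sum>k\<le>n. of_nat (n choose k) * ?a k (Suc n - k))"
    unfolding Suc.IH by (rule sum.cong) (simp_all only: atMost_iff Suc_diff_le funpow_Suc_right o_apply)
  also have "(Dx ^^ n) (Dx f * g) = (\<Sum>k\<le>n. of_nat (n choose k) * ?a (Suc k) (n - k))"
    unfolding Suc.IH by (rule sum.cong) (simp_all only: atMost_iff funpow_Suc_right o_apply)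
  also have "(\<Sum>k\<le>n. of_nat (n choose k) * ?a k (Suc n - k))
      = (\<Sum>k\<le>Suc n. of_nat (n choose k) * ?a k (Suc n - k))"
    by (simp del: funpow.simps add: binomial_eq_0)
  also have "\<dots> = ?a 0 (Suc n) + (\<Sum>k\<le>n. of_nat (n choose Suc k) * ?a (Suc k) (n - k))"
    by (subst sum.atMost_Suc_shift) (simp del: funpow.simps binomial_Suc_Suc add: binomial_eq_0)
  finally have "(Dx ^^ Suc n) (f * g) = ?a 0 (Suc n)
      + ((\<Sum>k\<le>n. of_nat (n choose Suc k) * ?a (Suc k) (n - k))
      + (\<Sum>k\<le>n. of_nat (n choose k) * ?a (Suc k) (n - k)))"
    by (simp only: add.assoc)
  also have "\<dots> = ?a 0 (Suc n) + (\<Sum>k\<le>n. of_nat (Suc n choose Suc k) * ?a (Suc k) (n - k))"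
    by (simp only: sum.distrib[symmetric] distrib_right[symmetric] of_nat_add[symmetric]
        binomial_Suc_Suc add.commute)
  also have "\<dots> = (\<Sum>k\<le>Suc n. of_nat (Suc n choose k) * ?a k (Suc n - k))"
    by (subst sum.atMost_Suc_shift) (simp del: funpow.simps binomial_Suc_Suc add: binomial_eq_0)
  finally show ?case .
qed simp

definition jet_swap :: "jet \<Rightarrow> jet" where
  "jet_swap u = (\<lambda>(j, k). u (Transposition.transpose 1 2 j, k))"

lemma continuous_jet_swap: "continuous_on UNIV jet_swap"
  unfolding jet_swap_def
  by (auto intro!: continuous_on_coordinatewise_then_product
      continuous_on_product_coordinates split: prod.split)

lemma jet_swap_upd: "jet_swap (u((j, k) := t)) = (jet_swap u)((Transposition.transpose 1 2 j, k) := t)"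
proof -
  have "Transposition.transpose 1 2 i = j \<longleftrightarrow> i = Transposition.transpose 1 2 j" for i :: 2
    by (metis transpose_involutory)
  then show ?thesis by (simp add: jet_swap_def fun_eq_iff)
qed

lemma pdiff_jet_swap:
  "pdiff (j, k) (\<lambda>u. f (jet_swap u)) = (\<lambda>u. pdiff (Transposition.transpose 1 2 j, k) f (jet_swap u))"
  by (simp add: fun_eq_iff pdiff_def jet_swap_upd) (simp add: jet_swap_def)

lemma Ck_jet_swap: "Ck n f \<Longrightarrow> Ck n (\<lambda>u. f (jet_swap u))"
proof (induction n arbitrary: f)
  case 0
  then show ?case
    using continuous_on_compose2[of UNIV f UNIV, OF _ continuous_jet_swap] by simp
next
  case (Suc n)
  have "continuous_on UNIV (\<lambda>u. f (jet_swap u))"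
    using Ck_continuous[OF Suc.prems] continuous_on_compose2[of UNIV f UNIV, OF _ continuous_jet_swap] by simp
  moreover have "(\<lambda>t. f (jet_swap (u((j, k) := t)))) field_differentiable (at (u (j, k)))" for u j k
    using Ck_field_differentiable[OF Suc.prems, of "jet_swap u" "(Transposition.transpose 1 2 j, k)"]
    by (simp only: jet_swap_upd) (simp add: jet_swap_def del: fun_upd_apply)
  moreover have "Ck n (pdiff (j, k) (\<lambda>u. f (jet_swap u)))" for j k
    unfolding pdiff_jet_swap using Suc by (simp del: split_paired_All)
  ultimately show ?case by simp
qed

lemma finite_jet_jet_swap: "finite_jet f \<Longrightarrow> finite_jet (\<lambda>u. f (jet_swap u))"
proof -
  assume "finite_jet f"
  then obtain n where "\<And>u w. (\<forall>j. \<forall>k\<le>n. u (j, k) = w (j, k)) \<Longrightarrow> f u = f w"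
    unfolding finite_jet_def by blast
  then have "f (jet_swap u) = f (jet_swap w)" if "\<forall>j. \<forall>k\<le>n. u (j, k) = w (j, k)" for u w
    using that by (simp add: jet_swap_def)
  then show ?thesis unfolding finite_jet_def by blast
qed

lift_definition dswap :: "dfun \<Rightarrow> dfun" is "\<lambda>f u. f (jet_swap u)"
  by (simp add: diff_functions_def finite_jet_jet_swap Ck_jet_swap)

lemma dswap_zero [simp]: "dswap 0 = 0"
  by transfer simp


section \<open>Formal pseudo-differential operators\<close>

text \<open>A formal series \<open>\<Sum>\<^sub>i p\<^sub>i D\<^sub>x\<^sup>i\<close> whose exponents are bounded above is represented by its
  coefficient function.\<close>

typedef psdo = "{p :: int \<Rightarrow> dfun. \<exists>N. \<forall>i>N. p i = 0}"
  morphisms pcoeff Abs_psdo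
  by (rule exI[of _ "\<lambda>_. 0"]) simp

lifting_forget dfun.lifting
setup_lifting type_definition_psdo

lemma psdo_eqI: "(\<And>n. pcoeff p n = pcoeff q n) \<Longrightarrow> p = q"
  by (simp add: fun_eq_iff flip: pcoeff_inject)

lemma pcoeff_bound: "\<exists>N. \<forall>i>N. pcoeff p i = 0"
  using pcoeff[of p] by auto

text \<open>The summand of \<open>(\<Sum>\<^sub>i p\<^sub>i D\<^sub>x\<^sup>i) (\<Sum>\<^sub>j q\<^sub>j D\<^sub>x\<^sup>j)\<close> contributed to \<open>D\<^sub>x\<^sup>n\<close> by \<open>(i, j)\<close>, according to
  \<open>D\<^sub>x\<^sup>i f = \<Sum>\<^sub>k (i gchoose k) D\<^sub>x\<^sup>k(f) D\<^sub>x\<^bsup>i-k\<^esup>\<close> with \<open>n = i + j - k\<close>.\<close>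

definition mult_term :: "(int \<Rightarrow> dfun) \<Rightarrow> (int \<Rightarrow> dfun) \<Rightarrow> int \<Rightarrow> int \<times> int \<Rightarrow> dfun" where
  "mult_term p q n = (\<lambda>(i, j). (of_int i gchoose nat (i + j - n)) *\<^sub>R
     (p i * (Dx ^^ nat (i + j - n)) (q j)))"

lemma finite_mult_range: "finite {(i::int, j). i \<le> M \<and> j \<le> N \<and> n \<le> i + j}"
  by (rule finite_subset[of _ "{n - N..M} \<times> {n - M..N}"]) auto

lemma mult_sum_bound:
  assumes "\<And>i. i > M \<Longrightarrow> p i = 0" "\<And>j. j > N \<Longrightarrow> q j = 0"
  shows "sum (mult_term p q n) {(i, j). p i \<noteq> 0 \<and> q j \<noteq> 0 \<and> n \<le> i + j}
    = sum (mult_term p q n) {(i, j). i \<le> M \<and> j \<le> N \<and> n \<le> i + j}"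
proof (rule sum.mono_neutral_left[OF finite_mult_range])
  show "{(i, j). p i \<noteq> 0 \<and> q j \<noteq> 0 \<and> n \<le> i + j} \<subseteq> {(i, j). i \<le> M \<and> j \<le> N \<and> n \<le> i + j}"
    using assms by (auto simp flip: not_less)
qed (auto simp: mult_term_def)

instantiation psdo :: ring_1
begin

lift_definition zero_psdo :: psdo is "\<lambda>_. 0"
  by simp

lift_definition one_psdo :: psdo is "\<lambda>i. if i = 0 then 1 else 0"
  by auto

lift_definition plus_psdo :: "psdo \<Rightarrow> psdo \<Rightarrow> psdo" is "\<lambda>p q i. p i + q i"
proof -
  fix p q :: "int \<Rightarrow> dfun"
  assume "\<exists>N. \<forall>i>N. p i = 0" "\<exists>N. \<forall>i>N. q i = 0"
  then obtain M N where "\<forall>i>M. p i = 0" "\<forall>i>N. q i = 0" by blast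
  then show "\<exists>N. \<forall>i>N. p i + q i = 0" by (intro exI[of _ "max M N"]) simp
qed

lift_definition uminus_psdo :: "psdo \<Rightarrow> psdo" is "\<lambda>p i. - p i"
  by simp

definition minus_psdo :: "psdo \<Rightarrow> psdo \<Rightarrow> psdo" where
  "minus_psdo p q = p + - q"

lift_definition times_psdo :: "psdo \<Rightarrow> psdo \<Rightarrow> psdo" is
  "\<lambda>p q n. sum (mult_term p q n) {(i, j). p i \<noteq> 0 \<and> q j \<noteq> 0 \<and> n \<le> i + j}"
proof -
  fix p q :: "int \<Rightarrow> dfun"
  assume "\<exists>N. \<forall>i>N. p i = 0" "\<exists>N. \<forall>i>N. q i = 0"
  then obtain M N where MN: "\<And>i. i > M \<Longrightarrow> p i = 0" "\<And>j. j > N \<Longrightarrow> q j = 0" by blast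
  have "n \<le> M + N" if "p i \<noteq> 0" "q j \<noteq> 0" "n \<le> i + j" for n i j
    using MN(1)[of i] MN(2)[of j] that by linarith
  then have empty: "{(i, j). p i \<noteq> 0 \<and> q j \<noteq> 0 \<and> n \<le> i + j} = {}" if "n > M + N" for n
    using that by (auto simp: not_le[symmetric])
  show "\<exists>N. \<forall>n>N. sum (mult_term p q n) {(i, j). p i \<noteq> 0 \<and> q j \<noteq> 0 \<and> n \<le> i + j} = 0"
    by (intro exI[of _ "M + N"] allI impI) (simp only: empty sum.empty)
qed

lemma pcoeff_mult:
  assumes "\<forall>i>M. pcoeff p i = 0" "\<forall>j>N. pcoeff q j = 0"
  shows "pcoeff (p * q) n =
    sum (mult_term (pcoeff p) (pcoeff q) n) {(i, j). i \<le> M \<and> j \<le> N \<and> n \<le> i + j}"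
  unfolding times_psdo.rep_eq by (rule mult_sum_bound) (use assms in auto)

lemma pcoeff_mult_zero:
  assumes "\<forall>i>M. pcoeff p i = 0" "\<forall>j>N. pcoeff q j = 0" "n > M + N"
  shows "pcoeff (p * q) n = 0"
proof -
  have empty: "{(i, j). i \<le> M \<and> j \<le> N \<and> n \<le> i + j} = {}" using assms(3) by auto
  have "pcoeff (p * q) n = sum (mult_term (pcoeff p) (pcoeff q) n) {}"
    using pcoeff_mult[OF assms(1,2), of n] unfolding empty .
  then show ?thesis by simp
qed

lemma mult_assoc_aux:
  "(\<Sum>k\<le>m. ((x + y - of_nat k gchoose (m - k)) * (x gchoose k)) *\<^sub>R
      ((Dx ^^ k) f * (Dx ^^ (m - k)) g))
   = (\<Sum>a\<le>m. ((x gchoose (m - a)) * (y gchoose a)) *\<^sub>R (Dx ^^ (m - a)) (f * (Dx ^^ a) g))"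
  for x y :: real
proof -
  let ?b = "\<lambda>k. (Dx ^^ k) f * (Dx ^^ (m - k)) g"
  have "(\<Sum>a\<le>m. ((x gchoose (m - a)) * (y gchoose a)) *\<^sub>R (Dx ^^ (m - a)) (f * (Dx ^^ a) g))
    = (\<Sum>a\<le>m. \<Sum>k\<in>{k\<in>{..m}. a + k \<le> m}.
        ((x gchoose k) * ((y gchoose a) * (x - of_nat k gchoose (m - k - a)))) *\<^sub>R ?b k)"
  proof (rule sum.cong[OF refl])
    fix a assume a: "a \<in> {..m}"
    have "(Dx ^^ (m - a)) (f * (Dx ^^ a) g)
      = (\<Sum>k\<le>m - a. of_nat (m - a choose k) * ((Dx ^^ k) f * (Dx ^^ (m - a - k + a)) g))"
      unfolding Dx_pow_mult by (simp add: funpow_add)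
    also have "\<dots> = (\<Sum>k\<le>m - a. of_nat (m - a choose k) * ?b k)"
      using a by (intro sum.cong) auto
    also have "((x gchoose (m - a)) * (y gchoose a)) *\<^sub>R \<dots>
      = (\<Sum>k\<le>m - a. ((x gchoose k) * ((y gchoose a) * (x - of_nat k gchoose (m - k - a)))) *\<^sub>R ?b k)"
      unfolding scaleR_sum_right
    proof (rule sum.cong[OF refl])
      fix k assume "k \<in> {..m - a}"
      then have "(x gchoose (m - a)) * real (m - a choose k)
          = (x gchoose k) * (x - of_nat k gchoose (m - a - k))"
        using gbinomial_trinomial_revision[of k "m - a" x]
        by (simp only: binomial_gbinomial atMost_iff)
      also have "m - a - k = m - k - a" by simp
      finally have "(x gchoose (m - a)) * (y gchoose a) * real (m - a choose k)
          = (x gchoose k) * ((y gchoose a) * (x - of_nat k gchoose (m - k - a)))"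
        by (simp only: mult.commute mult.left_commute)
      moreover have "of_nat (m - a choose k) * ?b k = real (m - a choose k) *\<^sub>R ?b k"
        by (simp only: scaleR_conv_of_real of_real_of_nat_eq)
      ultimately show "((x gchoose (m - a)) * (y gchoose a)) *\<^sub>R (of_nat (m - a choose k) * ?b k)
        = ((x gchoose k) * ((y gchoose a) * (x - of_nat k gchoose (m - k - a)))) *\<^sub>R ?b k"
        by (simp only: scaleR_scaleR)
    qed
    also have "{..m - a} = {k\<in>{..m}. a + k \<le> m}" using a by auto
    finally show "((x gchoose (m - a)) * (y gchoose a)) *\<^sub>R (Dx ^^ (m - a)) (f * (Dx ^^ a) g)
      = (\<Sum>k\<in>{k\<in>{..m}. a + k \<le> m}.
          ((x gchoose k) * ((y gchoose a) * (x - of_nat k gchoose (m - k - a)))) *\<^sub>R ?b k)" .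
  qed
  also have "\<dots> = (\<Sum>k\<le>m. \<Sum>a\<in>{a\<in>{..m}. a + k \<le> m}.
        ((x gchoose k) * ((y gchoose a) * (x - of_nat k gchoose (m - k - a)))) *\<^sub>R ?b k)"
    by (rule sum.swap_restrict) auto
  also have "\<dots> = (\<Sum>k\<le>m. ((x + y - of_nat k gchoose (m - k)) * (x gchoose k)) *\<^sub>R ?b k)"
  proof (rule sum.cong[OF refl])
    fix k assume "k \<in> {..m}"
    then have "{a\<in>{..m}. a + k \<le> m} = {0..m - k}" by auto
    then have "(\<Sum>a\<in>{a\<in>{..m}. a + k \<le> m}. (y gchoose a) * (x - of_nat k gchoose (m - k - a)))
      = (x + y - of_nat k gchoose (m - k))"
      using gbinomial_Vandermonde[of y "x - of_nat k" "m - k"] by (simp add: algebra_simps)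
    then show "(\<Sum>a\<in>{a\<in>{..m}. a + k \<le> m}.
        ((x gchoose k) * ((y gchoose a) * (x - of_nat k gchoose (m - k - a)))) *\<^sub>R ?b k)
      = ((x + y - of_nat k gchoose (m - k)) * (x gchoose k)) *\<^sub>R ?b k"
      by (simp add: mult.commute flip: scaleR_sum_left sum_distrib_left)
  qed
  finally show ?thesis by (rule sym)
qed

lemma psdo_mult_assoc: "p * q * r = p * (q * r)" for p q r :: psdo
proof (rule psdo_eqI)
  fix n
  obtain N1 where N1: "\<forall>i>N1. pcoeff p i = 0" using pcoeff_bound[of p] by blast
  obtain N2 where N2: "\<forall>i>N2. pcoeff q i = 0" using pcoeff_bound[of q] by blast
  obtain N3 where N3: "\<forall>i>N3. pcoeff r i = 0" using pcoeff_bound[of r] by blast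
  define a b c where "a = pcoeff p" and "b = pcoeff q" and "c = pcoeff r"
  let ?R = "\<lambda>M N n. {(i::int, j). i \<le> M \<and> j \<le> N \<and> n \<le> i + j}"
  define m where "m = (\<lambda>i j l. nat (i + j + l - n))"
  define T where "T = {(i, j, l). i \<le> N1 \<and> j \<le> N2 \<and> l \<le> N3 \<and> n \<le> i + j + l}"
  have finT: "finite T"
    by (rule finite_subset[of _ "{n - N2 - N3..N1} \<times> {n - N1 - N3..N2} \<times> {n - N1 - N2..N3}"])
      (auto simp: T_def)
  define C where "C = (\<lambda>(i, j, l). {..m i j l})"
  define A1 where "A1 = ?R (N1 + N2) N3 n"
  define B1 where "B1 = (\<lambda>(h, l::int). ?R N1 N2 h)"
  define G1 where "G1 = (\<lambda>(h, l) y. (of_int h gchoose nat (h + l - n)) *\<^sub>R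
    (mult_term a b h y * (Dx ^^ nat (h + l - n)) (c l)))"
  define H1 where "H1 = (\<lambda>(i, j, l) k.
    a i * (((of_int i + of_int j - of_nat k gchoose (m i j l - k)) * (of_int i gchoose k)) *\<^sub>R
      ((Dx ^^ k) (b j) * (Dx ^^ (m i j l - k)) (c l))))"
  define A2 where "A2 = ?R N1 (N2 + N3) n"
  define B2 where "B2 = (\<lambda>(i::int, g). ?R N2 N3 g)"
  define G2 where "G2 = (\<lambda>(i, g) y. (of_int i gchoose nat (i + g - n)) *\<^sub>R
    (a i * (Dx ^^ nat (i + g - n)) (mult_term b c g y)))"
  define H2 where "H2 = (\<lambda>(i, j, l) k.
    a i * (((of_int i gchoose (m i j l - k)) * (of_int j gchoose k)) *\<^sub>R
      (Dx ^^ (m i j l - k)) (b j * (Dx ^^ k) (c l))))"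
  have fin: "finite A1" "\<And>x. finite (B1 x)" "finite A2" "\<And>x. finite (B2 x)" "\<And>t. finite (C t)"
    by (auto simp: A1_def B1_def A2_def B2_def C_def finite_mult_range)
  have m1: "nat (i + j - int k + l - n) = m i j l - k" for i j l k
    unfolding m_def by arith
  have m2: "nat (i + (j + l - int k) - n) = m i j l - k" for i j l k
    unfolding m_def by arith
  have H: "(\<Sum>k\<in>C t. H1 t k) = (\<Sum>k\<in>C t. H2 t k)" for t
  proof -
    obtain i j l where t: "t = (i, j, l)" by (cases t)
    show ?thesis
      using mult_assoc_aux[where m = "m i j l" and x = "of_int i" and y = "of_int j"
          and f = "b j" and g = "c l"]
      by (simp only: t C_def H1_def H2_def prod.case sum_distrib_left[symmetric])
  qed
  have "pcoeff (p * q * r) n = (\<Sum>x\<in>A1. mult_term (pcoeff (p * q)) c n x)"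
    unfolding A1_def c_def by (rule pcoeff_mult) (simp_all add: pcoeff_mult_zero[OF N1 N2] N3)
  also have "\<dots> = (\<Sum>x\<in>A1. \<Sum>y\<in>B1 x. G1 x y)"
  proof (rule sum.cong[OF refl])
    fix x :: "int \<times> int"
    obtain h l where x: "x = (h, l)" by (cases x)
    show "mult_term (pcoeff (p * q)) c n x = (\<Sum>y\<in>B1 x. G1 x y)"
      by (simp only: x mult_term_def[of "pcoeff (p * q)"] B1_def G1_def prod.case
          pcoeff_mult[OF N1 N2] sum_distrib_right scaleR_sum_right a_def b_def)
  qed
  also have "\<dots> = (\<Sum>(x, y)\<in>Sigma A1 B1. G1 x y)"
    by (rule sum.Sigma) (simp_all add: fin)
  also have "\<dots> = (\<Sum>(t, k)\<in>Sigma T C. H1 t k)"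
  proof (rule sum.reindex_bij_witness[symmetric])
    let ?f = "\<lambda>((i, j, l), k). ((i + j - int k, l), (i, j))"
    let ?g = "\<lambda>((h, l), (i, j)). ((i, j, l), nat (i + j - h))"
    fix x :: "(int \<times> int \<times> int) \<times> nat"
    obtain i j l k where x: "x = ((i, j, l), k)" by (metis surj_pair)
    show "?g (?f x) = x" by (simp add: x)
    show "(case ?f x of (x, y) \<Rightarrow> G1 x y) = (case x of (t, k) \<Rightarrow> H1 t k)"
      by (simp add: x G1_def H1_def m1 mult_term_def mult.assoc)
    show "?f x \<in> Sigma A1 B1" if "x \<in> Sigma T C"
      using that by (auto simp: x T_def C_def A1_def B1_def m_def)
  next
    let ?f = "\<lambda>((i, j, l), k). ((i + j - int k, l), (i, j))"
    let ?g = "\<lambda>((h, l), (i, j)). ((i, j, l), nat (i + j - h))"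
    fix y assume "y \<in> Sigma A1 B1"
    then show "?f (?g y) = y" "?g y \<in> Sigma T C"
      by (auto simp: T_def C_def A1_def B1_def m_def)
  qed
  also have "\<dots> = (\<Sum>t\<in>T. \<Sum>k\<in>C t. H1 t k)"
    by (rule sum.Sigma[symmetric]) (simp_all add: fin finT)
  also have "\<dots> = (\<Sum>t\<in>T. \<Sum>k\<in>C t. H2 t k)"
    by (simp only: H)
  also have "\<dots> = (\<Sum>(t, k)\<in>Sigma T C. H2 t k)"
    by (rule sum.Sigma) (simp_all add: fin finT)
  also have "\<dots> = (\<Sum>(x, y)\<in>Sigma A2 B2. G2 x y)"
  proof (rule sum.reindex_bij_witness)
    let ?f = "\<lambda>((i, j, l), k). ((i, j + l - int k), (j, l))"
    let ?g = "\<lambda>((i, g), (j, l)). ((i, j, l), nat (j + l - g))"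
    fix x :: "(int \<times> int \<times> int) \<times> nat"
    obtain i j l k where x: "x = ((i, j, l), k)" by (metis surj_pair)
    show "?g (?f x) = x" by (simp add: x)
    show "(case ?f x of (x, y) \<Rightarrow> G2 x y) = (case x of (t, k) \<Rightarrow> H2 t k)"
      by (simp add: x G2_def H2_def m2 mult_term_def Dx_pow_scaleR)
    show "?f x \<in> Sigma A2 B2" if "x \<in> Sigma T C"
      using that by (auto simp: x T_def C_def A2_def B2_def m_def)
  next
    let ?f = "\<lambda>((i, j, l), k). ((i, j + l - int k), (j, l))"
    let ?g = "\<lambda>((i, g), (j, l)). ((i, j, l), nat (j + l - g))"
    fix y assume "y \<in> Sigma A2 B2"
    then show "?f (?g y) = y" "?g y \<in> Sigma T C"
      by (auto simp: T_def C_def A2_def B2_def m_def)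
  qed
  also have "\<dots> = (\<Sum>x\<in>A2. \<Sum>y\<in>B2 x. G2 x y)"
    by (rule sum.Sigma[symmetric]) (simp_all add: fin)
  also have "\<dots> = (\<Sum>x\<in>A2. mult_term a (pcoeff (q * r)) n x)"
  proof (rule sum.cong[OF refl])
    fix x :: "int \<times> int"
    obtain i g where x: "x = (i, g)" by (cases x)
    show "(\<Sum>y\<in>B2 x. G2 x y) = mult_term a (pcoeff (q * r)) n x"
      by (simp only: x mult_term_def[of _ "pcoeff (q * r)"] B2_def G2_def prod.case
          pcoeff_mult[OF N2 N3] sum_distrib_left scaleR_sum_right Dx_pow_sum b_def c_def)
  qed
  also have "\<dots> = pcoeff (p * (q * r)) n"
    unfolding A2_def a_def
    by (rule pcoeff_mult[symmetric]) (simp_all add: pcoeff_mult_zero[OF N2 N3] N1)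
  finally show "pcoeff (p * q * r) n = pcoeff (p * (q * r)) n" .
qed

lemma psdo_distrib_right: "(p + q) * r = p * r + q * r" for p q r :: psdo
proof (rule psdo_eqI)
  fix n
  obtain N1 where N1: "\<forall>i>N1. pcoeff p i = 0" using pcoeff_bound[of p] by blast
  obtain N2 where N2: "\<forall>i>N2. pcoeff q i = 0" using pcoeff_bound[of q] by blast
  obtain N where N: "\<forall>i>N. pcoeff r i = 0" using pcoeff_bound[of r] by blast
  define N' where "N' = max N1 N2"
  have N': "\<forall>i>N'. pcoeff p i = 0" "\<forall>i>N'. pcoeff q i = 0" "\<forall>i>N'. pcoeff (p + q) i = 0"
    using N1 N2 by (auto simp: plus_psdo.rep_eq N'_def)
  have E: "mult_term (pcoeff (p + q)) (pcoeff r) n = (\<lambda>v. mult_term (pcoeff p) (pcoeff r) n v + mult_term (pcoeff q) (pcoeff r) n v)"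
    by (rule ext) (simp add: split_def mult_term_def plus_psdo.rep_eq Dx_pow_add algebra_simps)
  show "pcoeff ((p + q) * r) n = pcoeff (p * r + q * r) n"
    by (simp only: plus_psdo.rep_eq[of "p * r"] pcoeff_mult[OF N'(1) N] pcoeff_mult[OF N'(2) N] pcoeff_mult[OF N'(3) N] E sum.distrib)
qed

lemma psdo_distrib_left: "p * (q + r) = p * q + p * r" for p q r :: psdo
proof (rule psdo_eqI)
  fix n
  obtain N1 where N1: "\<forall>i>N1. pcoeff q i = 0" using pcoeff_bound[of q] by blast
  obtain N2 where N2: "\<forall>i>N2. pcoeff r i = 0" using pcoeff_bound[of r] by blast
  obtain N where N: "\<forall>i>N. pcoeff p i = 0" using pcoeff_bound[of p] by blast
  define N' where "N' = max N1 N2"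
  have N': "\<forall>i>N'. pcoeff q i = 0" "\<forall>i>N'. pcoeff r i = 0" "\<forall>i>N'. pcoeff (q + r) i = 0"
    using N1 N2 by (auto simp: plus_psdo.rep_eq N'_def)
  have E: "mult_term (pcoeff p) (pcoeff (q + r)) n = (\<lambda>v. mult_term (pcoeff p) (pcoeff q) n v + mult_term (pcoeff p) (pcoeff r) n v)"
    by (rule ext) (simp add: split_def mult_term_def plus_psdo.rep_eq Dx_pow_add algebra_simps)
  show "pcoeff (p * (q + r)) n = pcoeff (p * q + p * r) n"
    by (simp only: plus_psdo.rep_eq[of "p * q"] pcoeff_mult[OF N N'(1)] pcoeff_mult[OF N N'(2)] pcoeff_mult[OF N N'(3)] E sum.distrib)
qed

lemma psdo_mult_1_left: "1 * p = p" for p :: psdo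
proof (rule psdo_eqI)
  fix n
  obtain N where N: "\<forall>i>N. pcoeff p i = 0" using pcoeff_bound[of p] by blast
  let ?R = "{(i, j). i \<le> 0 \<and> j \<le> N \<and> n \<le> i + j}"
  have "pcoeff (1 * p) n = sum (mult_term (pcoeff 1) (pcoeff p) n) ?R"
    by (rule pcoeff_mult) (auto simp: N one_psdo.rep_eq)
  also have "\<dots> = (\<Sum>x\<in>?R. if x = (0, n) then pcoeff p n else 0)"
  proof (rule sum.cong[OF refl])
    fix x assume "x \<in> ?R"
    then obtain i j where x: "x = (i, j)" "n \<le> i + j" by blast
    show "mult_term (pcoeff 1) (pcoeff p) n x = (if x = (0, n) then pcoeff p n else 0)"
    proof (cases "i = 0")
      case True
      then show ?thesis
        using x by (cases "nat (i + j - n)")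
          (auto simp: mult_term_def one_psdo.rep_eq Dx_pow_one)
    qed (use x in \<open>auto simp: mult_term_def one_psdo.rep_eq\<close>)
  qed
  also have "\<dots> = pcoeff p n"
    using N by (auto simp: sum.delta[OF finite_mult_range] not_le)
  finally show "pcoeff (1 * p) n = pcoeff p n" .
qed

lemma psdo_mult_1_right: "p * 1 = p" for p :: psdo
proof (rule psdo_eqI)
  fix n
  obtain N where N: "\<forall>i>N. pcoeff p i = 0" using pcoeff_bound[of p] by blast
  let ?R = "{(i, j). i \<le> N \<and> j \<le> 0 \<and> n \<le> i + j}"
  have "pcoeff (p * 1) n = sum (mult_term (pcoeff p) (pcoeff 1) n) ?R"
    by (rule pcoeff_mult) (auto simp: N one_psdo.rep_eq)
  also have "\<dots> = (\<Sum>x\<in>?R. if x = (n, 0) then pcoeff p n else 0)"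
  proof (rule sum.cong[OF refl])
    fix x assume "x \<in> ?R"
    then obtain i j where x: "x = (i, j)" "n \<le> i + j" by blast
    show "mult_term (pcoeff p) (pcoeff 1) n x = (if x = (n, 0) then pcoeff p n else 0)"
    proof (cases "j = 0")
      case True
      then show ?thesis
        using x by (cases "nat (i + j - n)")
          (auto simp: mult_term_def one_psdo.rep_eq Dx_pow_one)
    qed (use x in \<open>auto simp: mult_term_def one_psdo.rep_eq\<close>)
  qed
  also have "\<dots> = pcoeff p n"
    using N by (auto simp: sum.delta[OF finite_mult_range] not_le)
  finally show "pcoeff (p * 1) n = pcoeff p n" .
qed

instance
proof
  show "(0::psdo) \<noteq> 1" by transfer (metis zero_neq_one)
  show "p - q = p + - q" for p q :: psdo by (rule minus_psdo_def)
  show "p + q + r = p + (q + r)" "p + q = q + p" "0 + p = p" "- p + p = 0" for p q r :: psdo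
    by (rule psdo_eqI; simp add: plus_psdo.rep_eq zero_psdo.rep_eq uminus_psdo.rep_eq algebra_simps)+
qed (rule psdo_mult_assoc psdo_distrib_left psdo_distrib_right psdo_mult_1_left psdo_mult_1_right)+

end

lift_definition pmonom :: "dfun \<Rightarrow> int \<Rightarrow> psdo" is "\<lambda>f n i. if i = n then f else 0"
  by auto

abbreviation pmult :: "dfun \<Rightarrow> psdo" where
  "pmult f \<equiv> pmonom f 0"

abbreviation DX :: psdo where
  "DX \<equiv> pmonom 1 1"

abbreviation DX_inv :: psdo where
  "DX_inv \<equiv> pmonom 1 (- 1)"

lemma pcoeff_pmonom_mult:
  "pcoeff (pmonom f i * pmonom g j) n = (if n \<le> i + j
     then (of_int i gchoose nat (i + j - n)) *\<^sub>R (f * (Dx ^^ nat (i + j - n)) g) else 0)"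
proof -
  let ?A = "{(k, l). k \<le> i \<and> l \<le> j \<and> n \<le> k + l}"
  have "pcoeff (pmonom f i * pmonom g j) n
      = sum (mult_term (pcoeff (pmonom f i)) (pcoeff (pmonom g j)) n) ?A"
    by (rule pcoeff_mult) (auto simp: pmonom.rep_eq)
  also have "\<dots> = (\<Sum>x\<in>?A. if x = (i, j) then
      (of_int i gchoose nat (i + j - n)) *\<^sub>R (f * (Dx ^^ nat (i + j - n)) g) else 0)"
    by (rule sum.cong) (auto simp: mult_term_def pmonom.rep_eq split: if_splits)
  also have "\<dots> = (if n \<le> i + j
     then (of_int i gchoose nat (i + j - n)) *\<^sub>R (f * (Dx ^^ nat (i + j - n)) g) else 0)"
    by (subst sum.delta[OF finite_mult_range]) auto
  finally show ?thesis .
qed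

lemma pmonom_1_mult: "pmonom f i * pmonom 1 j = pmonom f (i + j)"
  by (rule psdo_eqI) (auto simp: pcoeff_pmonom_mult pmonom.rep_eq Dx_pow_one)

lemma pmult_mult: "pmult f * pmonom g j = pmonom (f * g) j"
proof (rule psdo_eqI)
  fix n
  show "pcoeff (pmult f * pmonom g j) n = pcoeff (pmonom (f * g) j) n"
    by (cases "nat (j - n)") (auto simp: pcoeff_pmonom_mult pmonom.rep_eq)
qed

lemma pmonom_1_0: "pmonom 1 0 = 1"
  by (rule psdo_eqI) (simp add: pmonom.rep_eq one_psdo.rep_eq)

lemma DX_inv_left: "DX_inv * DX = 1"
  and DX_inv_right: "DX * DX_inv = 1"
  by (simp_all add: pmonom_1_mult pmonom_1_0)

lemma DX_mult: "DX * pmult f = pmult f * DX + pmult (Dx f)"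
proof (rule psdo_eqI)
  fix n :: int
  consider "n > 1" | "n = 1" | "n = 0" | "n < 0" by linarith
  then show "pcoeff (DX * pmult f) n = pcoeff (pmult f * DX + pmult (Dx f)) n"
  proof cases
    case 4
    have "1 < nat (1 - n)" using 4 by simp
    then have "(1::real) gchoose nat (1 - n) = 0"
      using binomial_gbinomial[of 1 "nat (1 - n)", where 'a = real]
      by (simp add: binomial_eq_0 del: zero_less_nat_eq)
    then show ?thesis using 4
      by (simp add: pcoeff_pmonom_mult plus_psdo.rep_eq pmonom_1_mult pmonom.rep_eq)
  qed (simp_all add: pcoeff_pmonom_mult plus_psdo.rep_eq pmonom_1_mult pmonom.rep_eq)
qed

text \<open>The swap acts on the coefficients of the expanded series. As \<open>dswap\<close> is a ring
  homomorphism commuting with \<open>Dx\<close>, this agrees with swapping \<open>a\<close> and \<open>s\<close> in \<open>a D\<^sub>x\<^sup>-\<^sup>1 s\<close>.\<close>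

lift_definition psdo_swap :: "psdo \<Rightarrow> psdo" is "\<lambda>p i. dswap (p i)"
  by (metis dswap_zero)

lift_definition psdo_evolve :: "dfun ^ 2 \<Rightarrow> psdo \<Rightarrow> psdo" is "\<lambda>K p i. evolve K (p i)"
  by (metis evolve_def vfield_zero)


section \<open>Recursion operators\<close>

lift_definition frechet_entry :: "dfun \<Rightarrow> 2 \<Rightarrow> psdo" is
  "\<lambda>f j i. if 0 \<le> i then pd (j, nat i) f else 0"
proof -
  fix f and j :: 2
  define S where "S = (\<lambda>v. int (snd v)) ` {v. pd v f \<noteq> 0}"
  have "bdd_above S"
    unfolding S_def by (intro bdd_above_finite finite_imageI finite_pd_support)
  then obtain N where N: "\<forall>i\<in>S. i \<le> N" unfolding bdd_above_def by blast
  have "pd (j, nat i) f = 0" if "i > N" "0 \<le> i" for i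
  proof (rule ccontr)
    assume "pd (j, nat i) f \<noteq> 0"
    then have "int (snd (j, nat i)) \<in> S" unfolding S_def by blast
    then show False using N that by auto
  qed
  then show "\<exists>N. \<forall>i>N. (if 0 \<le> i then pd (j, nat i) f else 0) = 0" by auto
qed

definition frechet :: "dfun ^ 2 \<Rightarrow> psdo ^ 2 ^ 2" where
  "frechet K = (\<chi> i j. frechet_entry (K $ i) j)"

definition op_evolve :: "dfun ^ 2 \<Rightarrow> psdo ^ 2 ^ 2 \<Rightarrow> psdo ^ 2 ^ 2" where
  "op_evolve K R = (\<chi> i j. psdo_evolve K (R $ i $ j))"

text \<open>Products such as \<open>frechet K ** R\<close> are compositions: matrix multiplication over the
  noncommutative ring of pseudo-differential operators.\<close>

definition lie_derivative :: "dfun ^ 2 \<Rightarrow> psdo ^ 2 ^ 2 \<Rightarrow> psdo ^ 2 ^ 2" where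
  "lie_derivative K R = op_evolve K R - frechet K ** R + R ** frechet K"

definition recursion_operator :: "dfun ^ 2 \<Rightarrow> psdo ^ 2 ^ 2 \<Rightarrow> bool" where
  "recursion_operator K R \<longleftrightarrow> lie_derivative K R = 0"

definition has_order :: "psdo ^ 2 ^ 2 \<Rightarrow> int \<Rightarrow> bool" where
  "has_order R n \<longleftrightarrow> (\<exists>i j. pcoeff (R $ i $ j) n \<noteq> 0)
     \<and> (\<forall>m>n. \<forall>i j. pcoeff (R $ i $ j) m = 0)"


section \<open>The system and its operator\<close>

abbreviation phi1 :: dfun where "phi1 \<equiv> jvar 1 0"
abbreviation phi1_x :: dfun where "phi1_x \<equiv> jvar 1 1"
abbreviation phi1_xx :: dfun where "phi1_xx \<equiv> jvar 1 2"
abbreviation phi1_xxx :: dfun where "phi1_xxx \<equiv> jvar 1 3"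
abbreviation phi2 :: dfun where "phi2 \<equiv> jvar 2 0"
abbreviation phi2_x :: dfun where "phi2_x \<equiv> jvar 2 1"
abbreviation phi2_xx :: dfun where "phi2_xx \<equiv> jvar 2 2"
abbreviation phi2_xxx :: dfun where "phi2_xxx \<equiv> jvar 2 3"

definition v1 :: dfun where "v1 = dexp phi1"
definition v2 :: dfun where "v2 = dexp phi2"
definition v3 :: dfun where "v3 = dexp (- phi1 - phi2)"

definition phi1_t :: dfun where
  "phi1_t = phi1_xx + 2 * phi2_xx + 2 * phi1_x * phi2_x + phi1_x^2
     + 3 * dexp (2 * phi2) - 3 * dexp (- 2 * phi1 - 2 * phi2)"

definition phi2_t :: dfun where
  "phi2_t = - 2 * phi1_xx - phi2_xx - 2 * phi1_x * phi2_x - phi2_x^2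
     - 3 * dexp (2 * phi1) + 3 * dexp (- 2 * phi1 - 2 * phi2)"

definition system_rhs :: "dfun ^ 2" where
  "system_rhs = vector [phi1_t, phi2_t]"

definition s1_phi1 :: dfun where
  "s1_phi1 = - 2 * phi1_xx - phi2_xx - 6 * dexp (2 * phi1) + 6 * dexp (- 2 * phi1 - 2 * phi2)"

definition s1_phi2 :: dfun where
  "s1_phi2 = - phi1_xx - 2 * phi2_xx - 6 * dexp (2 * phi2) + 6 * dexp (- 2 * phi1 - 2 * phi2)"

definition s2_phi1 :: dfun where
  "s2_phi1 = - 3 * phi2_xxx - 4 * phi1_x * phi1_xx + 2 * phi2_x * phi2_xx
     - 2 * phi1_xx * phi2_x - 2 * phi1_x * phi2_xx
     - 12 * (dexp (2 * phi1) + dexp (2 * phi2) + dexp (- 2 * phi1 - 2 * phi2)) * phi2_x"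

definition s2_phi2 :: dfun where
  "s2_phi2 = 3 * phi1_xxx - 2 * phi1_x * phi1_xx + 4 * phi2_x * phi2_xx
     + 2 * phi1_xx * phi2_x + 2 * phi1_x * phi2_xx
     + 12 * (dexp (2 * phi1) + dexp (2 * phi2) + dexp (- 2 * phi1 - 2 * phi2)) * phi1_x"

definition R11 :: psdo where
  "R11 = pmult ((1/3) *\<^sub>R 1) * DX^3
     + pmult ((2/3) *\<^sub>R (phi1_x + phi2_x)) * DX^2
     + pmult ((1/9) *\<^sub>R (3 * phi1_xx - phi1_x * phi2_x + 3 * phi2_xx - phi1_x^2 - phi2_x^2
         + 21 * v3^2 + 3 * v2^2 + 3 * v1^2)) * DX
     + pmult (- ((1/9) *\<^sub>R (7 * phi1_x * phi2_xx + phi1_xx * phi2_x + 2 * phi1_x * phi1_xx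
           + 2 * phi2_x * phi2_xx + 4 * phi1_x^3 + 7 * phi1_x^2 * phi2_x + phi1_x * phi2_x^2))
         + (1/3) *\<^sub>R ((5 * v1^2 - 4 * v2^2 - 7 * v3^2) * phi1_x)
         + (1/3) *\<^sub>R ((8 * v1^2 - v2^2 - 13 * v3^2) * phi2_x))
     - pmult ((1/9) *\<^sub>R phi1_x) * DX_inv * pmult s2_phi1
     - pmult ((1/9) *\<^sub>R phi1_t) * DX_inv * pmult s1_phi1"

definition R12 :: psdo where
  "R12 = pmult ((2/3) *\<^sub>R 1) * DX^3
     + pmult ((2/3) *\<^sub>R phi1_x) * DX^2
     + pmult ((1/9) *\<^sub>R (3 * phi1_xx - 2 * phi1_x^2 - 2 * phi1_x * phi2_x - 2 * phi2_x^2
         + 6 * v1^2 + 24 * v2^2 + 24 * v3^2)) * DX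
     + pmult ((2/9) *\<^sub>R (phi1_x * phi1_xx - phi1_x * phi2_xx - phi2_x * phi1_xx
           - 2 * phi2_x * phi2_xx - phi1_x^3 - phi1_x^2 * phi2_x - phi1_x * phi2_x^2)
         + (2/3) *\<^sub>R ((v1^2 + v2^2 - 5 * v3^2) * phi1_x)
         + 4 * (v2^2 - v3^2) * phi2_x)
     - pmult ((1/9) *\<^sub>R phi1_x) * DX_inv * pmult s2_phi2
     - pmult ((1/9) *\<^sub>R phi1_t) * DX_inv * pmult s1_phi2"

definition R_op :: "psdo ^ 2 ^ 2" where
  "R_op = vector [vector [R11, R12], vector [- psdo_swap R12, - psdo_swap R11]]"

end

theory Submission
  imports Defs
begin

text \<open>The operator splits as \<open>L + \<Sum> p D\<^sub>x\<^sup>-\<^sup>1 q\<close> with a differential operator \<open>L\<close>, where \<open>p\<close>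
  runs through multiples of the symmetries \<open>\<phi>\<^sub>x\<close>, \<open>\<phi>\<^sub>t\<close> and \<open>q\<close> through the cosymmetries \<open>s\<^sub>2\<close>, \<open>s\<^sub>1\<close>,
  the variational derivatives of conserved densities. Moving \<open>D\<^sub>x\<close> past \<open>D\<^sub>x\<^sup>-\<^sup>1\<close>, the nonlocal
  part of the Lie derivative is \<open>\<Sum> L\<^sub>K(p) D\<^sub>x\<^sup>-\<^sup>1 q + p D\<^sub>x\<^sup>-\<^sup>1 L\<^sub>K(q) = 0\<close>. What remains is a matrix
  of differential operators of order at most 5, whose coefficients vanish by polynomial
  identities in the jet variables and the exponentials.\<close>

section \<open>Derivations on differential functions\<close>

lemma dexp_mult: "dexp f * dexp g = dexp (f + g)"
  by (simp add: dfun_apply_inject[symmetric] fun_eq_iff dexp.rep_eq times_dfun.rep_eq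
      plus_dfun.rep_eq exp_add)

lemma dexp_power2: "(dexp f)\<^sup>2 = dexp (2 * f)"
  by (simp add: power2_eq_square dexp_mult)

lemma vfield_minus: "vfield Q (- f) = - vfield Q f"
  using vfield_scaleR[of Q "- 1" f] by simp

lemma vfield_diff: "vfield Q (f - g) = vfield Q f - vfield Q g"
  using vfield_add[of Q f "- g"] by (simp add: vfield_minus)

text \<open>A numeral is a real multiple of 1, so real linearity reduces the claim to the constant
  1.\<close>

lemma vfield_numeral: "vfield Q (numeral n) = 0"
  using vfield_scaleR[of Q "numeral n" 1] by (simp add: scaleR_conv_of_real)

lemma vfield_power2: "vfield Q (f\<^sup>2) = 2 * f * vfield Q f"
  by (simp add: power2_eq_square vfield_mult algebra_simps)

lemma vfield_power3: "vfield Q (f ^ 3) = 3 * f\<^sup>2 * vfield Q f"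
  by (simp add: power3_eq_cube power2_eq_square vfield_mult algebra_simps)

lemmas vfield_simps = vfield_add vfield_diff vfield_minus vfield_mult vfield_scaleR
  vfield_numeral vfield_power2 vfield_power3 vfield_exp vfield_zero vfield_one

text \<open>\<open>Dx\<close> and \<open>evolve K\<close> are both instances of
  \<open>vfield\<close>, so one list of derivation rules serves both.\<close>

lemmas Dx_simps = vfield_simps[of "\<lambda>(j, k). jvar j (Suc k)", folded Dx_def]

lemmas evolve_simps = vfield_simps[of "\<lambda>(j, k). (Dx ^^ k) (K $ j)" for K, folded evolve_def]

lemma evolve_jvar: "evolve K (jvar j k) = (Dx ^^ k) (K $ j)"
  by (simp add: evolve_def vfield_jvar)

lemma pd_minus: "pd v (- f) = - pd v f"
  using pd_scaleR[of v "- 1" f] by simp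

lemma pd_diff: "pd v (f - g) = pd v f - pd v g"
  using pd_add[of v f "- g"] by (simp add: pd_minus)

lemma pd_numeral: "pd v (numeral n) = 0"
  using pd_scaleR[of v "numeral n" 1] by (simp add: scaleR_conv_of_real)

lemma pd_power2: "pd v (f\<^sup>2) = 2 * f * pd v f"
  by (simp add: power2_eq_square pd_mult algebra_simps)

lemmas pd_simps = pd_add pd_diff pd_minus pd_mult pd_numeral pd_power2 pd_exp pd_jvar
  pd_zero pd_one

section \<open>The interchange of the two dependent variables\<close>

lemma dswap_add: "dswap (f + g) = dswap f + dswap g"
  and dswap_mult: "dswap (f * g) = dswap f * dswap g"
  and dswap_minus: "dswap (- f) = - dswap f"
  and dswap_scaleR: "dswap (c *\<^sub>R f) = c *\<^sub>R dswap f"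
  and dswap_one: "dswap 1 = 1"
  and dswap_dexp: "dswap (dexp f) = dexp (dswap f)"
  and dswap_jvar: "dswap (jvar j k) = jvar (Transposition.transpose 1 2 j) k"
  by (simp_all add: dfun_apply_inject[symmetric] fun_eq_iff dswap.rep_eq plus_dfun.rep_eq
      times_dfun.rep_eq uminus_dfun.rep_eq scaleR_dfun.rep_eq one_dfun.rep_eq dexp.rep_eq
      jvar.rep_eq jet_swap_def)

lemma dswap_diff: "dswap (f - g) = dswap f - dswap g"
  using dswap_add[of f "- g"] by (simp add: dswap_minus)

lemma dswap_numeral: "dswap (numeral n) = numeral n"
  using dswap_scaleR[of "numeral n" 1] by (simp add: dswap_one scaleR_conv_of_real)

lemma dswap_power: "dswap (f ^ n) = dswap f ^ n"
  by (induction n) (simp_all add: dswap_one dswap_mult)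

lemmas dswap_simps = dswap_add dswap_diff dswap_minus dswap_mult dswap_scaleR dswap_one
  dswap_numeral dswap_power dswap_dexp dswap_jvar

text \<open>On elementary functions \<open>Dx\<close> commutes with \<open>evolve K\<close> by structural induction, which
  avoids the symmetry of second partial derivatives.\<close>

inductive elementary :: "dfun \<Rightarrow> bool" where
  jvar: "elementary (jvar j k)"
| one: "elementary 1"
| scaleR: "elementary f \<Longrightarrow> elementary (c *\<^sub>R f)"
| add: "elementary f \<Longrightarrow> elementary g \<Longrightarrow> elementary (f + g)"
| mult: "elementary f \<Longrightarrow> elementary g \<Longrightarrow> elementary (f * g)"
| dexp: "elementary f \<Longrightarrow> elementary (dexp f)"

lemma elementary_minus: "elementary f \<Longrightarrow> elementary (- f)"
  using elementary.scaleR[of f "- 1"] by simp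

lemma elementary_diff: "elementary f \<Longrightarrow> elementary g \<Longrightarrow> elementary (f - g)"
  using elementary.add[of f "- g"] by (simp add: elementary_minus)

lemma elementary_numeral: "elementary (numeral n)"
  using elementary.scaleR[OF elementary.one, of "numeral n"] by (simp add: scaleR_conv_of_real)

lemma elementary_power: "elementary f \<Longrightarrow> elementary (f ^ n)"
  by (induction n) (auto intro: elementary.intros)

lemmas elementary_intros = elementary.intros elementary_minus elementary_diff
  elementary_numeral elementary_power

lemma elementary_Dx: "elementary f \<Longrightarrow> elementary (Dx f)"
proof (induction rule: elementary.induct)
  case one
  \<comment> \<open>\<open>Dx 1\<close> is zero, which is elementary as the multiple
    \<open>0 *\<^sub>R 1\<close>.\<close>
  then show ?case using elementary.scaleR[OF elementary.one, of 0] by simp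
qed (auto simp: Dx_simps Dx_jvar intro: elementary.intros)

lemma elementary_Dx_pow: "elementary f \<Longrightarrow> elementary ((Dx ^^ n) f)"
  by (induction n) (auto intro: elementary_Dx)

text \<open>At \<open>jvar j k\<close> both sides are \<open>(Dx ^^ Suc k) (K $ j)\<close>; the
  derivation rules carry this through the other constructors.\<close>

lemma evolve_Dx: "elementary f \<Longrightarrow> evolve K (Dx f) = Dx (evolve K f)"
  by (induction rule: elementary.induct)
    (simp_all add: Dx_simps evolve_simps Dx_jvar evolve_jvar algebra_simps)

lemma evolve_Dx_pow: "elementary f \<Longrightarrow> evolve K ((Dx ^^ n) f) = (Dx ^^ n) (evolve K f)"
  by (induction n) (simp_all add: evolve_Dx elementary_Dx_pow)

text \<open>The swap moves only the first index of a jet variable, \<open>Dx\<close> only the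
  second.\<close>

lemma dswap_Dx: "elementary f \<Longrightarrow> dswap (Dx f) = Dx (dswap f)"
  by (induction rule: elementary.induct)
    (simp_all add: Dx_simps dswap_simps Dx_jvar)

lemma dswap_Dx_pow: "elementary f \<Longrightarrow> dswap ((Dx ^^ n) f) = (Dx ^^ n) (dswap f)"
  by (induction n) (simp_all add: dswap_Dx elementary_Dx_pow)


section \<open>Differential operators and their nonlocal extensions\<close>

lemma pmonom_zero [simp]: "pmonom 0 n = 0"
  by (rule psdo_eqI) (simp add: pmonom.rep_eq zero_psdo.rep_eq)

lemma pmonom_add: "pmonom (f + g) n = pmonom f n + pmonom g n"
  by (rule psdo_eqI) (simp add: pmonom.rep_eq plus_psdo.rep_eq)

text \<open>Unfolds the binomial coefficients 2 and 3 into repeated summands, so that iterated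
  Leibniz expansions match up to reordering.\<close>

lemma pmonom_double: "pmonom (2 * f) n = pmonom f n + pmonom f n"
  by (simp only: mult_2 pmonom_add)

lemma pmonom_triple: "pmonom (3 * f) n = pmonom f n + pmonom f n + pmonom f n"
proof -
  have "3 * f = 2 * f + f"
    using distrib_right[of 2 1 f] by simp
  then show ?thesis by (simp only: pmonom_add pmonom_double)
qed

lemma pmonom_minus: "pmonom (- f) n = - pmonom f n"
  by (rule psdo_eqI) (simp add: pmonom.rep_eq uminus_psdo.rep_eq)

lemma pmonom_diff: "pmonom (f - g) n = pmonom f n - pmonom g n"
  using pmonom_add[of f "- g"] by (simp add: pmonom_minus)

lemma DX_pmonom: "DX * pmonom g j = pmonom g (j + 1) + pmonom (Dx g) j"
proof -
  have "DX * pmonom g j = DX * pmult g * pmonom 1 j"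
    by (simp add: mult.assoc pmonom_1_mult)
  then show ?thesis by (simp add: DX_mult distrib_right mult.assoc pmonom_1_mult add.commute)
qed

text \<open>Peels one \<open>DX\<close> off the left factor by the Leibniz rule; repeated use gives
  the explicit products for powers 1, 2 and 3.\<close>

lemma pmonom_Suc_mult:
  "pmonom f (i + 1) * pmonom g j = pmonom f i * pmonom g (j + 1) + pmonom f i * pmonom (Dx g) j"
proof -
  have "pmonom f (i + 1) * pmonom g j = pmonom f i * (DX * pmonom g j)"
    by (simp add: pmonom_1_mult flip: mult.assoc)
  then show ?thesis by (simp add: DX_pmonom distrib_left)
qed

lemma pmonom_1_pmonom: "pmonom f 1 * pmonom g j = pmonom (f * g) (j + 1) + pmonom (f * Dx g) j"
  using pmonom_Suc_mult[of f 0] by (simp add: pmult_mult)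

lemma pmonom_2_pmonom:
  "pmonom f 2 * pmonom g j
    = pmonom (f * g) (j + 2) + pmonom (2 * (f * Dx g)) (j + 1) + pmonom (f * Dx (Dx g)) j"
  using pmonom_Suc_mult[of f 1]
  by (simp add: pmonom_1_pmonom pmonom_double add_ac)

lemma pmonom_3_pmonom:
  "pmonom f 3 * pmonom g j = pmonom (f * g) (j + 3) + pmonom (3 * (f * Dx g)) (j + 2)
    + pmonom (3 * (f * Dx (Dx g))) (j + 1) + pmonom (f * Dx (Dx (Dx g))) j"
  using pmonom_Suc_mult[of f 2]
  by (simp add: pmonom_2_pmonom pmonom_double pmonom_triple add_ac)

text \<open>Order 5 suffices for the product of an operator of order 3 with a Frechet derivative of
  order 2.\<close>

definition dop :: "dfun \<Rightarrow> dfun \<Rightarrow> dfun \<Rightarrow> dfun \<Rightarrow> dfun \<Rightarrow> dfun \<Rightarrow> psdo" where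
  "dop a0 a1 a2 a3 a4 a5 = pmult a0 + pmonom a1 1 + pmonom a2 2 + pmonom a3 3
     + pmonom a4 4 + pmonom a5 5"

lemma dop_add: "dop a0 a1 a2 a3 a4 a5 + dop b0 b1 b2 b3 b4 b5
    = dop (a0 + b0) (a1 + b1) (a2 + b2) (a3 + b3) (a4 + b4) (a5 + b5)"
  by (simp add: dop_def pmonom_add)

lemma dop_diff: "dop a0 a1 a2 a3 a4 a5 - dop b0 b1 b2 b3 b4 b5
    = dop (a0 - b0) (a1 - b1) (a2 - b2) (a3 - b3) (a4 - b4) (a5 - b5)"
  by (simp add: dop_def pmonom_diff)

lemma dop_minus: "- dop a0 a1 a2 a3 a4 a5 = dop (- a0) (- a1) (- a2) (- a3) (- a4) (- a5)"
  by (simp add: dop_def pmonom_minus)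

lemma dop_mult_2_3: "dop a0 a1 a2 0 0 0 * dop b0 b1 b2 b3 0 0 = dop
    (a0 * b0 + a1 * Dx b0 + a2 * Dx (Dx b0))
    (a0 * b1 + a1 * (b0 + Dx b1) + a2 * (2 * Dx b0 + Dx (Dx b1)))
    (a0 * b2 + a1 * (b1 + Dx b2) + a2 * (b0 + 2 * Dx b1 + Dx (Dx b2)))
    (a0 * b3 + a1 * (b2 + Dx b3) + a2 * (b1 + 2 * Dx b2 + Dx (Dx b3)))
    (a1 * b3 + a2 * (b2 + 2 * Dx b3))
    (a2 * b3)"
  by (simp add: dop_def distrib_left distrib_right pmult_mult pmonom_1_pmonom pmonom_2_pmonom
      pmonom_add ac_simps)

lemma dop_mult_3_2: "dop b0 b1 b2 b3 0 0 * dop a0 a1 a2 0 0 0 = dop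
    (b0 * a0 + b1 * Dx a0 + b2 * Dx (Dx a0) + b3 * Dx (Dx (Dx a0)))
    (b0 * a1 + b1 * (a0 + Dx a1) + b2 * (2 * Dx a0 + Dx (Dx a1))
      + b3 * (3 * Dx (Dx a0) + Dx (Dx (Dx a1))))
    (b0 * a2 + b1 * (a1 + Dx a2) + b2 * (a0 + 2 * Dx a1 + Dx (Dx a2))
      + b3 * (3 * Dx a0 + 3 * Dx (Dx a1) + Dx (Dx (Dx a2))))
    (b1 * a2 + b2 * (a1 + 2 * Dx a2) + b3 * (a0 + 3 * Dx a1 + 3 * Dx (Dx a2)))
    (b2 * a2 + b3 * (a1 + 3 * Dx a2))
    (b3 * a2)"
  by (simp add: dop_def distrib_left distrib_right pmult_mult pmonom_1_pmonom pmonom_2_pmonom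
      pmonom_3_pmonom pmonom_add ac_simps)

section \<open>Composition with nonlocal terms\<close>

definition nonlocal :: "dfun \<Rightarrow> dfun \<Rightarrow> psdo" where
  "nonlocal p q = pmult p * DX_inv * pmult q"

lemma nonlocal_add_left: "nonlocal (p + p') q = nonlocal p q + nonlocal p' q"
  by (simp add: nonlocal_def pmonom_add distrib_right)

lemma nonlocal_add_right: "nonlocal p (q + q') = nonlocal p q + nonlocal p q'"
  by (simp add: nonlocal_def pmonom_add distrib_left)

lemma nonlocal_minus_left: "nonlocal (- p) q = - nonlocal p q"
  by (simp add: nonlocal_def pmonom_minus)

lemma nonlocal_minus_right: "nonlocal p (- q) = - nonlocal p q"
  by (simp add: nonlocal_def pmonom_minus)

lemma nonlocal_diff_right: "nonlocal p (q - q') = nonlocal p q - nonlocal p q'"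
  using nonlocal_add_right[of p q "- q'"] by (simp add: nonlocal_minus_right)

lemma pmult_nonlocal: "pmult f * nonlocal p q = nonlocal (f * p) q"
  by (simp add: nonlocal_def pmult_mult flip: mult.assoc)

lemma nonlocal_pmult: "nonlocal p q * pmult f = nonlocal p (q * f)"
  by (simp add: nonlocal_def pmult_mult mult.assoc)

text \<open>Commuting \<open>DX\<close> past \<open>p\<close> produces \<open>Dx p\<close>; in the
  other term \<open>DX\<close> cancels \<open>DX_inv\<close>.\<close>

lemma DX_nonlocal: "DX * nonlocal p q = pmult (p * q) + nonlocal (Dx p) q"
proof -
  have "DX * nonlocal p q = DX * pmult p * DX_inv * pmult q"
    by (simp add: nonlocal_def mult.assoc)
  also have "\<dots> = pmult p * (DX * DX_inv) * pmult q + nonlocal (Dx p) q"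
    by (simp only: DX_mult distrib_right nonlocal_def mult.assoc)
  finally show ?thesis by (simp add: DX_inv_right pmult_mult)
qed

text \<open>From \<open>q D\<^sub>x = D\<^sub>x q - q\<^sub>x\<close>.\<close>

lemma nonlocal_DX: "nonlocal p q * DX = pmult (p * q) - nonlocal p (Dx q)"
proof -
  have "nonlocal p q * DX = pmult p * DX_inv * (DX * pmult q - pmult (Dx q))"
    by (simp add: nonlocal_def mult.assoc DX_mult)
  also have "\<dots> = pmult p * (DX_inv * DX) * pmult q - nonlocal p (Dx q)"
    by (simp only: right_diff_distrib nonlocal_def mult.assoc)
  finally show ?thesis by (simp add: DX_inv_left pmult_mult)
qed

text \<open>In the nonlocal part the differential operator is applied to \<open>p\<close>; the rest
  is local.\<close>

lemma dop_nonlocal: "dop a0 a1 a2 0 0 0 * nonlocal p q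
    = nonlocal (a0 * p + a1 * Dx p + a2 * Dx (Dx p)) q
      + dop (a1 * p * q + (2 * (a2 * (Dx p * q)) + a2 * (p * Dx q))) (a2 * p * q) 0 0 0 0"
proof -
  have 1: "pmonom f 1 * nonlocal p q = pmult (f * p * q) + nonlocal (f * Dx p) q" for f p q
  proof -
    have "pmonom f 1 * nonlocal p q = pmult f * (DX * nonlocal p q)"
      by (simp add: pmult_mult flip: mult.assoc)
    then show ?thesis by (simp add: DX_nonlocal distrib_left pmult_mult pmult_nonlocal mult.assoc)
  qed
  have "pmonom a2 2 * nonlocal p q = pmonom a2 1 * (DX * nonlocal p q)"
    by (simp add: pmonom_1_mult flip: mult.assoc)
  also have "\<dots> = nonlocal (a2 * Dx (Dx p)) q
      + dop (2 * (a2 * (Dx p * q)) + a2 * (p * Dx q)) (a2 * p * q) 0 0 0 0"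
    by (simp add: DX_nonlocal distrib_left 1 pmonom_1_pmonom Dx_simps dop_def pmonom_add
        pmonom_double mult.assoc add_ac)
  finally show ?thesis
    by (simp add: dop_def distrib_right 1 pmult_nonlocal nonlocal_add_left pmonom_add)
qed

text \<open>Integration by parts: each \<open>DX\<close> moved left through \<open>q\<close> changes
  sign, so in the nonlocal part the formal adjoint is applied to \<open>q\<close>.\<close>

lemma nonlocal_dop: "nonlocal p q * dop a0 a1 a2 0 0 0
    = nonlocal p (q * a0 - Dx (q * a1) + Dx (Dx (q * a2)))
      + dop (p * (q * a1) - p * Dx (q * a2)) (p * (q * a2)) 0 0 0 0"
proof -
  have 1: "nonlocal p q * pmonom f 1 = pmult (p * (q * f)) - nonlocal p (Dx (q * f))" for f
  proof -
    have "nonlocal p q * pmonom f 1 = nonlocal p (q * f) * DX"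
      by (simp add: pmonom_1_mult mult.assoc flip: nonlocal_pmult)
    then show ?thesis by (simp add: nonlocal_DX)
  qed
  have "nonlocal p q * pmonom a2 2 = nonlocal p q * pmonom a2 1 * DX"
    by (simp add: pmonom_1_mult mult.assoc)
  also have "\<dots> = pmonom (p * (q * a2)) 1 - nonlocal p (Dx (q * a2)) * DX"
    by (simp add: 1 left_diff_distrib pmonom_1_mult)
  also have "\<dots> = nonlocal p (Dx (Dx (q * a2))) + dop (- (p * Dx (q * a2))) (p * (q * a2)) 0 0 0 0"
    by (simp add: nonlocal_DX dop_def pmonom_minus)
  finally show ?thesis
    by (simp add: dop_def distrib_left 1 nonlocal_pmult nonlocal_add_right nonlocal_diff_right
        pmonom_add pmonom_diff pmonom_minus)
qed

lemma pcoeff_nonlocal: "pcoeff (nonlocal p q) n = (if n \<le> - 1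
    then (of_int (- 1) gchoose nat (- 1 - n)) *\<^sub>R (p * (Dx ^^ nat (- 1 - n)) q) else 0)"
  by (simp add: nonlocal_def pmonom_1_mult pcoeff_pmonom_mult)

section \<open>Evolution and swap of differential and nonlocal operators\<close>

lemma psdo_evolve_add: "psdo_evolve K (p + q) = psdo_evolve K p + psdo_evolve K q"
  by (rule psdo_eqI) (simp add: psdo_evolve.rep_eq plus_psdo.rep_eq evolve_simps)

lemma psdo_evolve_dop: "psdo_evolve K (dop a0 a1 a2 a3 a4 a5)
    = dop (evolve K a0) (evolve K a1) (evolve K a2) (evolve K a3) (evolve K a4) (evolve K a5)"
  by (rule psdo_eqI)
    (simp add: psdo_evolve.rep_eq dop_def plus_psdo.rep_eq pmonom.rep_eq evolve_simps)

text \<open>The coefficients of \<open>DX_inv * pmult q\<close> are multiples of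
  \<open>(Dx ^^ k) q\<close>, so the product rule takes this form once \<open>evolve K\<close>
  commutes with \<open>Dx\<close>; hence the condition on \<open>q\<close>.\<close>

lemma psdo_evolve_nonlocal:
  "elementary q \<Longrightarrow> psdo_evolve K (nonlocal p q) = nonlocal (evolve K p) q + nonlocal p (evolve K q)"
  by (rule psdo_eqI) (simp add: psdo_evolve.rep_eq plus_psdo.rep_eq pcoeff_nonlocal evolve_simps
      evolve_Dx_pow scaleR_add_right)

lemma psdo_swap_add: "psdo_swap (p + q) = psdo_swap p + psdo_swap q"
  by (rule psdo_eqI) (simp add: psdo_swap.rep_eq plus_psdo.rep_eq dswap_add)

lemma psdo_swap_dop: "psdo_swap (dop a0 a1 a2 a3 a4 a5)
    = dop (dswap a0) (dswap a1) (dswap a2) (dswap a3) (dswap a4) (dswap a5)"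
  by (rule psdo_eqI)
    (simp add: psdo_swap.rep_eq dop_def plus_psdo.rep_eq pmonom.rep_eq dswap_add)

lemma psdo_swap_nonlocal:
  "elementary q \<Longrightarrow> psdo_swap (nonlocal p q) = nonlocal (dswap p) (dswap q)"
  by (rule psdo_eqI) (simp add: psdo_swap.rep_eq pcoeff_nonlocal dswap_simps dswap_Dx_pow)

lemma dop_eq_0:
  "a0 = 0 \<Longrightarrow> a1 = 0 \<Longrightarrow> a2 = 0 \<Longrightarrow> a3 = 0 \<Longrightarrow> a4 = 0 \<Longrightarrow> a5 = 0
    \<Longrightarrow> dop a0 a1 a2 a3 a4 a5 = 0"
  by (simp add: dop_def)

lemma pcoeff_dop: "pcoeff (dop a0 a1 a2 a3 a4 a5) n = (if n = 0 then a0 else if n = 1 then a1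
    else if n = 2 then a2 else if n = 3 then a3 else if n = 4 then a4 else if n = 5 then a5 else 0)"
  by (simp add: dop_def plus_psdo.rep_eq pmonom.rep_eq)

section \<open>The Lie derivative along a field of order at most 2\<close>

lemma frechet_order_2:
  assumes "\<And>i j k. k > 2 \<Longrightarrow> pd (j, k) (K $ i) = 0"
  shows "frechet K $ i $ j = dop (pd (j, 0) (K $ i)) (pd (j, 1) (K $ i)) (pd (j, 2) (K $ i)) 0 0 0"
proof (rule psdo_eqI)
  fix n :: int
  consider "n < 0" | "n = 0" | "n = 1" | "n = 2" | "nat n > 2" by linarith
  then show "pcoeff (frechet K $ i $ j) n
      = pcoeff (dop (pd (j, 0) (K $ i)) (pd (j, 1) (K $ i)) (pd (j, 2) (K $ i)) 0 0 0) n"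
    by cases (auto simp: frechet_def frechet_entry.rep_eq pcoeff_dop assms)
qed

lemma lie_derivative_add: "lie_derivative K (R + S) = lie_derivative K R + lie_derivative K S"
  by (simp add: vec_eq_iff lie_derivative_def op_evolve_def matrix_matrix_mult_def
      psdo_evolve_add distrib_left distrib_right sum.distrib)

definition nonlocal_matrix :: "dfun ^ 2 \<Rightarrow> dfun ^ 2 \<Rightarrow> psdo ^ 2 ^ 2" where
  "nonlocal_matrix p q = (\<chi> i j. nonlocal (p $ i) (q $ j))"

text \<open>For \<open>K\<close> of order at most 2, the sums are \<open>D\<^sub>K p\<close> and \<open>D\<^sub>K\<^sup>* q\<close>, the latter for the formal
  adjoint of the Frechet derivative.\<close>

definition symmetry :: "dfun ^ 2 \<Rightarrow> dfun ^ 2 \<Rightarrow> bool" where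
  "symmetry K p \<longleftrightarrow> (\<forall>i. evolve K (p $ i) = (\<Sum>j\<in>UNIV. pd (j, 0) (K $ i) * p $ j
      + pd (j, 1) (K $ i) * Dx (p $ j) + pd (j, 2) (K $ i) * Dx (Dx (p $ j))))"

definition cosymmetry :: "dfun ^ 2 \<Rightarrow> dfun ^ 2 \<Rightarrow> bool" where
  "cosymmetry K q \<longleftrightarrow> (\<forall>j. evolve K (q $ j) = - (\<Sum>i\<in>UNIV. q $ i * pd (j, 0) (K $ i)
      - Dx (q $ i * pd (j, 1) (K $ i)) + Dx (Dx (q $ i * pd (j, 2) (K $ i)))))"

text \<open>The symmetry condition cancels the nonlocal terms with left factor
  \<open>evolve K p\<close>, the cosymmetry condition those with right factor
  \<open>evolve K q\<close>. Only the local remainders of \<open>dop_nonlocal\<close> and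
  \<open>nonlocal_dop\<close> survive.\<close>

lemma lie_derivative_nonlocal:
  assumes order: "\<And>i j k. k > 2 \<Longrightarrow> pd (j, k) (K $ i) = 0"
    and symmetry: "symmetry K p"
    and cosymmetry: "cosymmetry K q"
    and q: "\<And>j. elementary (q $ j)"
  shows "lie_derivative K (nonlocal_matrix p q) $ i $ j = (\<Sum>m\<in>UNIV.
    dop (p $ i * (q $ m * pd (j, 1) (K $ m)) - p $ i * Dx (q $ m * pd (j, 2) (K $ m)))
      (p $ i * (q $ m * pd (j, 2) (K $ m))) 0 0 0 0
    - dop (pd (m, 1) (K $ i) * p $ m * q $ j + (2 * (pd (m, 2) (K $ i) * (Dx (p $ m) * q $ j))
        + pd (m, 2) (K $ i) * (p $ m * Dx (q $ j))))
      (pd (m, 2) (K $ i) * p $ m * q $ j) 0 0 0 0)"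
  unfolding lie_derivative_def nonlocal_matrix_def op_evolve_def matrix_matrix_mult_def
  by (simp add: sum_2 psdo_evolve_nonlocal q symmetry[unfolded symmetry_def]
      cosymmetry[unfolded cosymmetry_def] frechet_order_2[OF order] dop_nonlocal nonlocal_dop
      nonlocal_add_left nonlocal_add_right nonlocal_minus_right nonlocal_diff_right)

lemma lie_derivative_dop:
  assumes order: "\<And>i j k. k > 2 \<Longrightarrow> pd (j, k) (K $ i) = 0"
  shows "lie_derivative K (\<chi> i j. dop (a0 i j) (a1 i j) (a2 i j) (a3 i j) 0 0) $ i $ j
    = dop (evolve K (a0 i j)) (evolve K (a1 i j)) (evolve K (a2 i j)) (evolve K (a3 i j)) 0 0
      + (\<Sum>m\<in>UNIV. dop (a0 i m) (a1 i m) (a2 i m) (a3 i m) 0 0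
          * dop (pd (j, 0) (K $ m)) (pd (j, 1) (K $ m)) (pd (j, 2) (K $ m)) 0 0 0
        - dop (pd (m, 0) (K $ i)) (pd (m, 1) (K $ i)) (pd (m, 2) (K $ i)) 0 0 0
          * dop (a0 m j) (a1 m j) (a2 m j) (a3 m j) 0 0)"
  unfolding lie_derivative_def op_evolve_def matrix_matrix_mult_def
  by (simp add: sum_2 psdo_evolve_dop frechet_order_2[OF order] evolve_simps)

section \<open>The system\<close>

abbreviation E1 :: dfun where "E1 \<equiv> dexp (2 * phi1)"
abbreviation E2 :: dfun where "E2 \<equiv> dexp (2 * phi2)"
abbreviation E3 :: dfun where "E3 \<equiv> dexp (- 2 * phi1 - 2 * phi2)"

lemma v_power2: "v1\<^sup>2 = E1" "v2\<^sup>2 = E2" "v3\<^sup>2 = E3"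
  by (simp_all add: v1_def v2_def v3_def dexp_power2 algebra_simps)

lemma Dx_jvar_numerals:
  "Dx (jvar j 0) = jvar j 1" "Dx (jvar j 1) = jvar j 2" "Dx (jvar j 2) = jvar j 3"
  "Dx (jvar j 3) = jvar j 4" "Dx (jvar j 4) = jvar j 5"
  by (simp_all add: Dx_jvar eval_nat_numeral)

lemma evolve_jvar_numerals:
  "evolve K (jvar j 0) = K $ j" "evolve K (jvar j 1) = Dx (K $ j)"
  "evolve K (jvar j 2) = Dx (Dx (K $ j))" "evolve K (jvar j 3) = Dx (Dx (Dx (K $ j)))"
  by (simp_all add: evolve_jvar eval_nat_numeral)

text \<open>Evaluation at a jet point turns an identity into a polynomial one over the reals, with
  the values of jet variables and exponentials as atoms for \<open>algebra\<close>.\<close>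

lemma dfun_eqI: "(\<And>u. dfun_apply f u = dfun_apply g u) \<Longrightarrow> f = g"
  by (simp add: fun_eq_iff flip: dfun_apply_inject)

lemma minus_dfun_apply: "dfun_apply (f - g) u = dfun_apply f u - dfun_apply g u"
  by (simp only: minus_dfun_def plus_dfun.rep_eq uminus_dfun.rep_eq diff_conv_add_uminus)

lemma numeral_dfun_apply: "dfun_apply (numeral n) u = numeral n"
proof -
  have "(numeral n :: dfun) = numeral n *\<^sub>R 1" by (simp add: scaleR_conv_of_real)
  then show ?thesis by (simp only: scaleR_dfun.rep_eq one_dfun.rep_eq mult_1_right)
qed

lemma power_dfun_apply: "dfun_apply (f ^ n) u = dfun_apply f u ^ n"
  by (induction n) (simp_all add: one_dfun.rep_eq times_dfun.rep_eq)

lemmas dfun_apply_simps = zero_dfun.rep_eq one_dfun.rep_eq plus_dfun.rep_eq minus_dfun_apply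
  uminus_dfun.rep_eq times_dfun.rep_eq scaleR_dfun.rep_eq numeral_dfun_apply power_dfun_apply

lemma system_rhs_nth: "system_rhs $ 1 = phi1_t" "system_rhs $ 2 = phi2_t"
  by (simp_all add: system_rhs_def vector_2)

lemma pd_phi_t:
  "pd (1, 0) phi1_t = 6 * E3" "pd (2, 0) phi1_t = 6 * E2 + 6 * E3"
  "pd (1, 1) phi1_t = 2 * phi1_x + 2 * phi2_x" "pd (2, 1) phi1_t = 2 * phi1_x"
  "pd (1, 2) phi1_t = 1" "pd (2, 2) phi1_t = 2"
  "pd (1, 0) phi2_t = - 6 * E1 - 6 * E3" "pd (2, 0) phi2_t = - 6 * E3"
  "pd (1, 1) phi2_t = - 2 * phi2_x" "pd (2, 1) phi2_t = - 2 * phi1_x - 2 * phi2_x"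
  "pd (1, 2) phi2_t = - 2" "pd (2, 2) phi2_t = - 1"
  by (simp_all add: phi1_t_def phi2_t_def pd_simps algebra_simps)

lemma system_order: "k > 2 \<Longrightarrow> pd (j, k) (system_rhs $ i) = 0"
proof -
  assume "k > 2"
  then have "pd (j, k) phi1_t = 0" "pd (j, k) phi2_t = 0"
    by (simp_all add: phi1_t_def phi2_t_def pd_simps)
  then show ?thesis
    using exhaust_2[of i] by (metis system_rhs_nth)
qed

lemmas ring_0 = mult_zero_left mult_zero_right add_0_left add_0_right minus_zero diff_zero diff_0
  scaleR_zero_right

lemmas expand = evolve_simps evolve_jvar_numerals system_rhs_nth phi1_t_def phi2_t_def
  s1_phi1_def s1_phi2_def s2_phi1_def s2_phi2_def Dx_simps Dx_jvar_numerals ring_0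

section \<open>Symmetries and cosymmetries of the system\<close>

lemma symmetry_scaleR: "symmetry K p \<Longrightarrow> symmetry K (c *\<^sub>R p)"
  by (simp add: symmetry_def evolve_simps Dx_simps scaleR_sum_right scaleR_add_right)

text \<open>Translation in x: by the chain rule both sides are the total x-derivative of the
  right-hand side.\<close>

lemma symmetry_phi_x: "symmetry system_rhs (vector [phi1_x, phi2_x])"
  unfolding symmetry_def forall_2
  by (simp only: sum_2 vector_2 system_rhs_nth pd_phi_t, simp only: expand,
      intro conjI; rule dfun_eqI; simp only: dfun_apply_simps; algebra)

text \<open>Translation in time: both sides are the derivative of the right-hand side along
  itself.\<close>

lemma symmetry_phi_t: "symmetry system_rhs system_rhs"
  unfolding symmetry_def forall_2
  by (simp only: sum_2 system_rhs_nth pd_phi_t, simp only: expand,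
      intro conjI; rule dfun_eqI; simp only: dfun_apply_simps; algebra)

text \<open>The pair is the variational derivative of
  \<open>phi1_x^2 + phi1_x phi2_x + phi2_x^2 - 3 (E1 + E2 + E3)\<close>.\<close>

lemma cosymmetry_s1: "cosymmetry system_rhs (vector [s1_phi1, s1_phi2])"
  unfolding cosymmetry_def forall_2
  by (simp only: sum_2 vector_2 system_rhs_nth pd_phi_t, simp only: expand,
      intro conjI; rule dfun_eqI; simp only: dfun_apply_simps; algebra)

text \<open>The pair is the variational derivative of \<open>3 phi1_x phi2_xx + 2/3 phi1_x^3 +
  phi1_x^2 phi2_x - phi1_x phi2_x^2 - 2/3 phi2_x^3 + (6 E2 - 3 E3) phi1_x + (3 E3 - 6 E1)
  phi2_x\<close>.\<close>

lemma cosymmetry_s2: "cosymmetry system_rhs (vector [s2_phi1, s2_phi2])"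
  unfolding cosymmetry_def forall_2
  by (simp only: sum_2 vector_2 system_rhs_nth pd_phi_t, simp only: expand,
      intro conjI; rule dfun_eqI; simp only: dfun_apply_simps; algebra)

lemma elementary_s:
  "elementary s1_phi1" "elementary s1_phi2" "elementary s2_phi1" "elementary s2_phi2"
  unfolding s1_phi1_def s1_phi2_def s2_phi1_def s2_phi2_def
  by (intro elementary_intros)+

text \<open>Nine times the coefficients of the differential parts of \<open>R11\<close> and \<open>R12\<close>, cleared of
  denominators because \<open>algebra\<close> does not normalise fractions.\<close>

definition R11_coeff0 :: dfun where
  "R11_coeff0 = - (7 * phi1_x * phi2_xx + phi1_xx * phi2_x + 2 * phi1_x * phi1_xx
      + 2 * phi2_x * phi2_xx + 4 * phi1_x^3 + 7 * phi1_x^2 * phi2_x + phi1_x * phi2_x^2)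
    + 3 * (5 * E1 - 4 * E2 - 7 * E3) * phi1_x + 3 * (8 * E1 - E2 - 13 * E3) * phi2_x"

definition R11_coeff1 :: dfun where
  "R11_coeff1 = 3 * phi1_xx - phi1_x * phi2_x + 3 * phi2_xx - phi1_x^2 - phi2_x^2
    + 21 * E3 + 3 * E2 + 3 * E1"

definition R11_coeff2 :: dfun where
  "R11_coeff2 = 6 * (phi1_x + phi2_x)"

definition R12_coeff0 :: dfun where
  "R12_coeff0 = 2 * (phi1_x * phi1_xx - phi1_x * phi2_xx - phi2_x * phi1_xx
      - 2 * phi2_x * phi2_xx - phi1_x^3 - phi1_x^2 * phi2_x - phi1_x * phi2_x^2)
    + 6 * (E1 + E2 - 5 * E3) * phi1_x + 36 * (E2 - E3) * phi2_x"

definition R12_coeff1 :: dfun where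
  "R12_coeff1 = 3 * phi1_xx - 2 * phi1_x^2 - 2 * phi1_x * phi2_x - 2 * phi2_x^2
    + 6 * E1 + 24 * E2 + 24 * E3"

definition R12_coeff2 :: dfun where
  "R12_coeff2 = 6 * phi1_x"

lemmas coeff_defs = R11_coeff0_def R11_coeff1_def R11_coeff2_def
  R12_coeff0_def R12_coeff1_def R12_coeff2_def

section \<open>Local and nonlocal parts of the four entries\<close>

lemma dop_nonlocal_eqI:
  assumes "c0 = d0" "c1 = d1" "c2 = d2" "c3 = d3"
  shows "pmult c3 * DX ^ 3 + pmult c2 * DX\<^sup>2 + pmult c1 * DX + pmult c0
      - pmult p * DX_inv * pmult q - pmult p' * DX_inv * pmult q'
    = dop d0 d1 d2 d3 0 0 + nonlocal (- p) q + nonlocal (- p') q'"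
proof -
  have "DX\<^sup>2 = pmonom 1 2" "DX ^ 3 = pmonom 1 3"
    by (simp_all add: power2_eq_square power3_eq_cube pmonom_1_mult)
  then show ?thesis
    by (simp add: assms dop_def nonlocal_def pmonom_minus pmonom_1_mult add_ac)
qed

lemma R11_eq: "R11
    = dop ((1/9) *\<^sub>R R11_coeff0) ((1/9) *\<^sub>R R11_coeff1) ((1/9) *\<^sub>R R11_coeff2)
        ((1/9) *\<^sub>R 3) 0 0
    + nonlocal (- ((1/9) *\<^sub>R phi1_x)) s2_phi1 + nonlocal (- ((1/9) *\<^sub>R phi1_t)) s1_phi1"
  unfolding R11_def v_power2 coeff_defs
  by (rule dop_nonlocal_eqI; rule dfun_eqI; simp add: dfun_apply_simps field_simps)

lemma R12_eq: "R12
    = dop ((1/9) *\<^sub>R R12_coeff0) ((1/9) *\<^sub>R R12_coeff1) ((1/9) *\<^sub>R R12_coeff2)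
        ((1/9) *\<^sub>R 6) 0 0
    + nonlocal (- ((1/9) *\<^sub>R phi1_x)) s2_phi2 + nonlocal (- ((1/9) *\<^sub>R phi1_t)) s1_phi2"
  unfolding R12_def v_power2 coeff_defs
  by (rule dop_nonlocal_eqI; rule dfun_eqI; simp add: dfun_apply_simps field_simps)

lemma dswap_var [simp]: "dswap (jvar 1 k) = jvar 2 k" "dswap (jvar 2 k) = jvar 1 k"
  by (simp_all add: dswap_jvar)

lemma dswap_E: "dswap E1 = E2" "dswap E2 = E1" "dswap E3 = E3"
proof -
  have "- 2 * phi2 - 2 * phi1 = - 2 * phi1 - 2 * phi2" by simp
  then show "dswap E3 = E3" by (simp only: dswap_dexp dswap_diff dswap_mult dswap_minus
        dswap_numeral dswap_var)
qed (simp_all add: dswap_simps)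

lemmas dswap_expand = dswap_E dswap_var dswap_add dswap_diff dswap_minus dswap_mult dswap_scaleR
  dswap_one dswap_numeral dswap_power

text \<open>The system is invariant under the swap combined with time reversal, which accounts for
  the minus signs in the lower row of \<open>R_op\<close>.\<close>

lemma dswap_phi_t: "dswap phi1_t = - phi2_t" "dswap phi2_t = - phi1_t"
  unfolding phi1_t_def phi2_t_def dswap_expand by (simp_all add: algebra_simps)

lemma dswap_s:
  "dswap s1_phi1 = s1_phi2" "dswap s1_phi2 = s1_phi1"
  "dswap s2_phi1 = - s2_phi2" "dswap s2_phi2 = - s2_phi1"
  unfolding s1_phi1_def s1_phi2_def s2_phi1_def s2_phi2_def dswap_expand
  by (simp_all add: algebra_simps)

text \<open>The outer minus sign cancels against the oddness of \<open>s2\<close> in the first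
  nonlocal term and of the flow in the second, so the lower row has the same nonlocal form as the
  upper one.\<close>

lemma R21_eq: "- psdo_swap R12
    = dop ((1/9) *\<^sub>R - dswap R12_coeff0) ((1/9) *\<^sub>R - dswap R12_coeff1)
        ((1/9) *\<^sub>R - dswap R12_coeff2) ((1/9) *\<^sub>R - dswap 6) 0 0
    + nonlocal (- ((1/9) *\<^sub>R phi2_x)) s2_phi1 + nonlocal (- ((1/9) *\<^sub>R phi2_t)) s1_phi1"
  unfolding R12_eq psdo_swap_add psdo_swap_dop psdo_swap_nonlocal[OF elementary_s(2)]
    psdo_swap_nonlocal[OF elementary_s(4)] dswap_s dswap_var dswap_scaleR dswap_phi_t dswap_minus
  by (simp add: dop_minus nonlocal_minus_left nonlocal_minus_right)

lemma R22_eq: "- psdo_swap R11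
    = dop ((1/9) *\<^sub>R - dswap R11_coeff0) ((1/9) *\<^sub>R - dswap R11_coeff1)
        ((1/9) *\<^sub>R - dswap R11_coeff2) ((1/9) *\<^sub>R - dswap 3) 0 0
    + nonlocal (- ((1/9) *\<^sub>R phi2_x)) s2_phi2 + nonlocal (- ((1/9) *\<^sub>R phi2_t)) s1_phi2"
  unfolding R11_eq psdo_swap_add psdo_swap_dop psdo_swap_nonlocal[OF elementary_s(1)]
    psdo_swap_nonlocal[OF elementary_s(3)] dswap_s dswap_var dswap_scaleR dswap_phi_t dswap_minus
  by (simp add: dop_minus nonlocal_minus_left nonlocal_minus_right)

definition antiswap :: "dfun \<Rightarrow> dfun \<Rightarrow> 2 \<Rightarrow> 2 \<Rightarrow> dfun" where
  "antiswap a b i j = (if i = 1 then if j = 1 then a else b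
     else if j = 1 then - dswap b else - dswap a)"

lemma antiswap_simps:
  "antiswap a b 1 1 = a" "antiswap a b 1 2 = b"
  "antiswap a b 2 1 = - dswap b" "antiswap a b 2 2 = - dswap a"
  by (simp_all add: antiswap_def)

text \<open>Equals \<open>9 c R_op\<close>; its Lie derivative vanishes with \<open>c\<close> treated as an indeterminate.\<close>

definition R_multiple :: "real \<Rightarrow> psdo ^ 2 ^ 2" where
  "R_multiple c = (\<chi> i j. dop (c *\<^sub>R antiswap R11_coeff0 R12_coeff0 i j)
      (c *\<^sub>R antiswap R11_coeff1 R12_coeff1 i j)
      (c *\<^sub>R antiswap R11_coeff2 R12_coeff2 i j) (c *\<^sub>R antiswap 3 6 i j) 0 0)
    + nonlocal_matrix ((- c) *\<^sub>R vector [phi1_x, phi2_x]) (vector [s2_phi1, s2_phi2])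
    + nonlocal_matrix ((- c) *\<^sub>R system_rhs) (vector [s1_phi1, s1_phi2])"

lemma R_op_eq: "R_op = R_multiple (1/9)"
  unfolding vec_eq_iff forall_2 R_op_def R_multiple_def nonlocal_matrix_def
  by (simp add: R21_eq R22_eq antiswap_simps system_rhs_nth) (simp add: R11_eq R12_eq)

lemma elementary_s_vector:
  "elementary (vector [s1_phi1, s1_phi2] $ (j :: 2))"
  "elementary (vector [s2_phi1, s2_phi2] $ (j :: 2))"
  using exhaust_2[of j] elementary_s by (auto simp: vector_2)

lemmas lie_derivative_entry =
  lie_derivative_dop[OF system_order]
  lie_derivative_nonlocal[OF system_order symmetry_scaleR[OF symmetry_phi_t] cosymmetry_s1
    elementary_s_vector(1)]
  lie_derivative_nonlocal[OF system_order symmetry_scaleR[OF symmetry_phi_x] cosymmetry_s2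
    elementary_s_vector(2)]

section \<open>The order and the vanishing Lie derivative\<close>

lemma has_order_R_op: "has_order R_op 3"
proof -
  have "pcoeff (R_op $ 1 $ 1) 3 = (1/9) *\<^sub>R 3"
    by (simp add: R_op_def R11_eq plus_psdo.rep_eq pcoeff_dop pcoeff_nonlocal)
  then have "pcoeff (R_op $ 1 $ 1) 3 \<noteq> 0"
    using numeral_dfun_apply[of "num.Bit1 num.One"] by (auto simp: zero_dfun.rep_eq)
  moreover have "pcoeff (R_op $ i $ j) m = 0" if "m > 3" for i j m
    using that by (simp add: R_op_eq R_multiple_def nonlocal_matrix_def plus_psdo.rep_eq
        pcoeff_dop pcoeff_nonlocal)
  ultimately show ?thesis unfolding has_order_def by blast
qed

theorem theorem3:
  shows "recursion_operator system_rhs R_op \<and> has_order R_op 3"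
proof
  have "lie_derivative system_rhs (R_multiple c) = 0" for c
    unfolding vec_eq_iff forall_2
    \<comment> \<open>With the nonlocal terms gone, each matrix entry collapses to a single
      \<open>dop\<close>; its six coefficients are then checked pointwise as polynomial identities
      that also contain \<open>c\<close>.\<close>
    by (intro conjI;
      simp only: R_multiple_def lie_derivative_add vector_add_component zero_index
        lie_derivative_entry sum_2 antiswap_simps dop_mult_2_3 dop_mult_3_2 dop_add dop_diff,
      simp only: vector_2 vector_scaleR_component system_rhs_nth pd_phi_t,
      rule dop_eq_0; simp only: coeff_defs dswap_expand; simp only: expand;
      rule dfun_eqI; simp only: dfun_apply_simps; (algebra | simp))
  then show "recursion_operator system_rhs R_op"
    by (simp only: recursion_operator_def R_op_eq)
qed (rule has_order_R_op)

end
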